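(* Let $\mathcal{A}$ and $\mathcal{B}$ be finite-dimensional unital $C^*$-algebras, let $\omega:\mathcal{A}\to\mathbb{C}$ be a state, let $F:\mathcal{B}\to\mathcal{A}$ be a completely positive unital (CPU) map, and set $\xi:=\omega\circ F$. i. If a CPU Bayesian inverse of $(F,\omega,\xi)$ exists, it is $\xi$-a.e. unique. ii. Suppose $G$ is a CPU Bayesian inverse of $(F,\omega,\xi)$. Then $F$ is $\omega$-a.e. deterministic if and only if $G$ is a disintegration of $(F,\omega,\xi)$. iii. If $(F,\omega,\xi)$ has a CPU disintegration $G$, then $F$ is $\omega$-a.e. deterministic and $G$ is a Bayesian inverse of $(F,\omega,\xi)$. iv. If $F$ is $\omega$-a.e. deterministic, then a CPU Bayesian inverse of $(F,\omega,\xi)$ exists if and only if a CPU disintegration of $(F,\omega,\xi)$ exists. v. Any two CPU disintegrations of $(F,\omega,\xi)$ are $\xi$-a.e. equivalent. vi. If $\mathcal{A}$ is commutative and $F$ is $\omega$-a.e. deterministic, a CPU disintegration of $(F,\omega,\xi)$ always exists. If either $\mathcal{A}$ is not commutative or $F$ is not $\omega$-a.e. deterministic, a CPU disintegration need not exist (i.e. there are such data admitting none). vii. If both $\mathcal{A}$ and $\mathcal{B}$ are commutative, a CPU Bayesian inverse of $(F,\omega,\xi)$ always exists. If at least one of $\mathcal{A}$ or $\mathcal{B}$ is not commutative, a CPU Bayesian inverse of $(F,\omega,\xi)$ need not exist (i.e. there are such data admitting none).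
   Context: A linear map $F:\mathcal{B}\to\mathcal{A}$ of unital $C^*$-algebras is completely positive unital (CPU) if it is unital and $\mathrm{id}_{\mathcal{M}_n(\mathbb{C})}\otimes F$ is positive for every $n$. A state is a positive unital linear functional. For a state $\xi$ on $\mathcal{B}$, linear $*$-preserving maps $H,K$ into $\mathcal{B}$ are $\xi$-a.e. equivalent if $\xi(B\,H(D))=\xi(B\,K(D))$ for all $B\in\mathcal{B}$ and all $D$ in their common domain (equivalently, $\xi(H(D)B)=\xi(K(D)B)$ for all $B,D$). "$\xi$-a.e. unique" means any two are $\xi$-a.e. equivalent. $F$ is $\omega$-a.e. deterministic if $\omega(A\,F(B_1)F(B_2))=\omega(A\,F(B_1B_2))$ for all $A\in\mathcal{A}$, $B_1,B_2\in\mathcal{B}$. A CPU Bayesian inverse of $(F,\omega,\xi)$ is a CPU map $G:\mathcal{A}\to\mathcal{B}$ with $\xi(G(A)B)=\omega(AF(B))$ for all $A\in\mathcal{A}$, $B\in\mathcal{B}$. A CPU disintegration of $(F,\omega,\xi)$ is a CPU map $G:\mathcal{A}\to\mathcal{B}$ with $\xi\circ G=\omega$ and $G\circ F$ $\xi$-a.e. equivalent to $\mathrm{id}_{\mathcal{B}}$. *)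

theory Defs
  imports "HOL-Analysis.Analysis" "HOL-Algebra.Algebra"
begin

section \<open>Unital star-algebras and finite-dimensional C*-algebras\<close>

record 'a star_algebra = "(complex, 'a) module" +
  star :: "'a \<Rightarrow> 'a"

record 'a cstar_algebra = "'a star_algebra" +
  nrm :: "'a \<Rightarrow> real"

definition complex_algebra :: "complex star_algebra" where
  "complex_algebra =
     \<lparr>carrier = UNIV, mult = (*), one = 1, ring.zero = 0, add = (+), smult = (*), star = cnj\<rparr>"

text \<open>The locale \<^locale>\<open>algebra\<close> of the library requires commutativity, hence the
  combination of \<^locale>\<open>ring\<close> and \<^locale>\<open>Module.module\<close>.\<close>

locale star_algebra = Module.module complex_algebra A + ring A
  for A :: "('a, 'm) star_algebra_scheme" (structure) +
  assumes smult_mult_left: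
      "x \<in> carrier A \<Longrightarrow> y \<in> carrier A \<Longrightarrow> (c \<odot> x) \<otimes> y = c \<odot> (x \<otimes> y)"
    and smult_mult_right:
      "x \<in> carrier A \<Longrightarrow> y \<in> carrier A \<Longrightarrow> x \<otimes> (c \<odot> y) = c \<odot> (x \<otimes> y)"
    and star_closed: "x \<in> carrier A \<Longrightarrow> star A x \<in> carrier A"
    and star_star: "x \<in> carrier A \<Longrightarrow> star A (star A x) = x"
    and star_add:
      "x \<in> carrier A \<Longrightarrow> y \<in> carrier A \<Longrightarrow> star A (x \<oplus> y) = star A x \<oplus> star A y"
    and star_smult: "x \<in> carrier A \<Longrightarrow> star A (c \<odot> x) = cnj c \<odot> star A x"
    and star_mult:
      "x \<in> carrier A \<Longrightarrow> y \<in> carrier A \<Longrightarrow> star A (x \<otimes> y) = star A y \<otimes> star A x"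

locale cstar_algebra = star_algebra A
  for A :: "('a, 'm) cstar_algebra_scheme" (structure) +
  assumes nrm_nonneg: "x \<in> carrier A \<Longrightarrow> 0 \<le> nrm A x"
    and nrm_eq_zero: "x \<in> carrier A \<Longrightarrow> nrm A x = 0 \<longleftrightarrow> x = \<zero>"
    and nrm_triangle:
      "x \<in> carrier A \<Longrightarrow> y \<in> carrier A \<Longrightarrow> nrm A (x \<oplus> y) \<le> nrm A x + nrm A y"
    and nrm_smult: "x \<in> carrier A \<Longrightarrow> nrm A (c \<odot> x) = cmod c * nrm A x"
    and nrm_mult:
      "x \<in> carrier A \<Longrightarrow> y \<in> carrier A \<Longrightarrow> nrm A (x \<otimes> y) \<le> nrm A x * nrm A y"
    and cstar_identity: "x \<in> carrier A \<Longrightarrow> nrm A (star A x \<otimes> x) = (nrm A x)\<^sup>2"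
    and nrm_complete: "Metric_space.mcomplete (carrier A) (\<lambda>x y. nrm A (x \<ominus> y))"

locale fd_cstar_algebra = cstar_algebra A
  for A :: "('a, 'm) cstar_algebra_scheme" (structure) +
  assumes finite_dim: "\<exists>S. finite S \<and> S \<subseteq> carrier A \<and>
    (\<forall>x \<in> carrier A. \<exists>c :: 'a \<Rightarrow> complex. x = (\<Oplus>s\<in>S. c s \<odot> s))"


section \<open>Completely positive unital maps and states\<close>

definition positive :: "('a, 'm) star_algebra_scheme \<Rightarrow> 'a \<Rightarrow> bool" where
  "positive A x \<longleftrightarrow> (\<exists>y \<in> carrier A. x = star A y \<otimes>\<^bsub>A\<^esub> y)"

definition linear_map ::
    "('a, 'm) star_algebra_scheme \<Rightarrow> ('b, 'n) star_algebra_scheme \<Rightarrow> ('a \<Rightarrow> 'b) \<Rightarrow> bool" where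
  "linear_map A B F \<longleftrightarrow>
     F \<in> carrier A \<rightarrow> carrier B \<and>
     (\<forall>x \<in> carrier A. \<forall>y \<in> carrier A. F (x \<oplus>\<^bsub>A\<^esub> y) = F x \<oplus>\<^bsub>B\<^esub> F y) \<and>
     (\<forall>c. \<forall>x \<in> carrier A. F (c \<odot>\<^bsub>A\<^esub> x) = c \<odot>\<^bsub>B\<^esub> F x)"

definition positive_map ::
    "('a, 'm) star_algebra_scheme \<Rightarrow> ('b, 'n) star_algebra_scheme \<Rightarrow> ('a \<Rightarrow> 'b) \<Rightarrow> bool" where
  "positive_map A B F \<longleftrightarrow> linear_map A B F \<and> (\<forall>x. positive A x \<longrightarrow> positive B (F x))"

text \<open>The algebra of \<open>n \<times> n\<close> matrices over \<open>A\<close>, i.e. the tensor product of the complex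
  \<open>n \<times> n\<close> matrices with \<open>A\<close>. Under this identification, the tensor product of the identity
  with \<open>F\<close> is the entrywise application of \<open>F\<close>.\<close>

definition mat_algebra ::
    "nat \<Rightarrow> ('a, 'm) star_algebra_scheme \<Rightarrow> (nat \<times> nat \<Rightarrow> 'a) star_algebra" where
  "mat_algebra n A =
     (let I = {..<n} \<times> {..<n} in
       \<lparr>carrier = I \<rightarrow>\<^sub>E carrier A,
        mult = (\<lambda>x y. (\<lambda>(i, j)\<in>I. (\<Oplus>\<^bsub>A\<^esub>k\<in>{..<n}. x (i, k) \<otimes>\<^bsub>A\<^esub> y (k, j)))),
        one = (\<lambda>(i, j)\<in>I. if i = j then \<one>\<^bsub>A\<^esub> else \<zero>\<^bsub>A\<^esub>),
        ring.zero = (\<lambda>p\<in>I. \<zero>\<^bsub>A\<^esub>),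
        add = (\<lambda>x y. (\<lambda>p\<in>I. x p \<oplus>\<^bsub>A\<^esub> y p)),
        smult = (\<lambda>c x. (\<lambda>p\<in>I. c \<odot>\<^bsub>A\<^esub> x p)),
        star = (\<lambda>x. (\<lambda>(i, j)\<in>I. star A (x (j, i))))\<rparr>)"

definition amplify :: "nat \<Rightarrow> ('a \<Rightarrow> 'b) \<Rightarrow> (nat \<times> nat \<Rightarrow> 'a) \<Rightarrow> nat \<times> nat \<Rightarrow> 'b" where
  "amplify n F x = (\<lambda>p\<in>{..<n} \<times> {..<n}. F (x p))"

definition cpu_map ::
    "('a, 'm) star_algebra_scheme \<Rightarrow> ('b, 'n) star_algebra_scheme \<Rightarrow> ('a \<Rightarrow> 'b) \<Rightarrow> bool" where
  "cpu_map A B F \<longleftrightarrow>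
     linear_map A B F \<and> F \<one>\<^bsub>A\<^esub> = \<one>\<^bsub>B\<^esub> \<and>
     (\<forall>n \<ge> 1. positive_map (mat_algebra n A) (mat_algebra n B) (amplify n F))"

definition state :: "('a, 'm) star_algebra_scheme \<Rightarrow> ('a \<Rightarrow> complex) \<Rightarrow> bool" where
  "state A \<omega> \<longleftrightarrow> positive_map A complex_algebra \<omega> \<and> \<omega> \<one>\<^bsub>A\<^esub> = 1"


section \<open>Almost everywhere notions, Bayesian inverses and disintegrations\<close>

text \<open>Equivalence of maps \<open>H, K\<close> from \<open>D\<close> to \<open>B\<close> with respect to a state \<open>\<xi>\<close> on \<open>B\<close>.\<close>

definition ae_equiv ::
    "('d, 'm) star_algebra_scheme \<Rightarrow> ('b, 'n) star_algebra_scheme \<Rightarrow> ('b \<Rightarrow> complex) \<Rightarrow>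
     ('d \<Rightarrow> 'b) \<Rightarrow> ('d \<Rightarrow> 'b) \<Rightarrow> bool" where
  "ae_equiv D B \<xi> H K \<longleftrightarrow>
     (\<forall>b \<in> carrier B. \<forall>d \<in> carrier D. \<xi> (b \<otimes>\<^bsub>B\<^esub> H d) = \<xi> (b \<otimes>\<^bsub>B\<^esub> K d))"

text \<open>In the remaining definitions, \<open>F\<close> maps \<open>B\<close> to \<open>A\<close>, \<open>\<omega>\<close> is a state on \<open>A\<close>,
  \<open>\<xi>\<close> a state on \<open>B\<close>, and \<open>G\<close> maps \<open>A\<close> to \<open>B\<close>.\<close>

definition ae_deterministic ::
    "('b, 'n) star_algebra_scheme \<Rightarrow> ('a, 'm) star_algebra_scheme \<Rightarrow> ('b \<Rightarrow> 'a) \<Rightarrow>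
     ('a \<Rightarrow> complex) \<Rightarrow> bool" where
  "ae_deterministic B A F \<omega> \<longleftrightarrow>
     (\<forall>a \<in> carrier A. \<forall>b\<^sub>1 \<in> carrier B. \<forall>b\<^sub>2 \<in> carrier B.
        \<omega> (a \<otimes>\<^bsub>A\<^esub> F b\<^sub>1 \<otimes>\<^bsub>A\<^esub> F b\<^sub>2) = \<omega> (a \<otimes>\<^bsub>A\<^esub> F (b\<^sub>1 \<otimes>\<^bsub>B\<^esub> b\<^sub>2)))"

definition cpu_bayesian_inverse ::
    "('b, 'n) star_algebra_scheme \<Rightarrow> ('a, 'm) star_algebra_scheme \<Rightarrow> ('b \<Rightarrow> 'a) \<Rightarrow>
     ('a \<Rightarrow> complex) \<Rightarrow> ('b \<Rightarrow> complex) \<Rightarrow> ('a \<Rightarrow> 'b) \<Rightarrow> bool" where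
  "cpu_bayesian_inverse B A F \<omega> \<xi> G \<longleftrightarrow>
     cpu_map A B G \<and>
     (\<forall>a \<in> carrier A. \<forall>b \<in> carrier B. \<xi> (G a \<otimes>\<^bsub>B\<^esub> b) = \<omega> (a \<otimes>\<^bsub>A\<^esub> F b))"

definition cpu_disintegration ::
    "('b, 'n) star_algebra_scheme \<Rightarrow> ('a, 'm) star_algebra_scheme \<Rightarrow> ('b \<Rightarrow> 'a) \<Rightarrow>
     ('a \<Rightarrow> complex) \<Rightarrow> ('b \<Rightarrow> complex) \<Rightarrow> ('a \<Rightarrow> 'b) \<Rightarrow> bool" where
  "cpu_disintegration B A F \<omega> \<xi> G \<longleftrightarrow>
     cpu_map A B G \<and>
     (\<forall>a \<in> carrier A. \<xi> (G a) = \<omega> a) \<and>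
     ae_equiv B B \<xi> (G \<circ> F) id"

definition bayes_data ::
    "('b, 'n) cstar_algebra_scheme \<Rightarrow> ('a, 'm) cstar_algebra_scheme \<Rightarrow> ('b \<Rightarrow> 'a) \<Rightarrow>
     ('a \<Rightarrow> complex) \<Rightarrow> bool" where
  "bayes_data B A F \<omega> \<longleftrightarrow>
     fd_cstar_algebra B \<and> fd_cstar_algebra A \<and> cpu_map B A F \<and> state A \<omega>"

text \<open>Every finite-dimensional C*-algebra is star-isomorphic to an algebra of complex matrices, so
  in assertions that certain data exist, nothing is lost by taking the elements of both algebras
  from this type. The algebras need not carry the operations of \<^const>\<open>mat_algebra\<close>.\<close>

type_synonym matrix_algebra = "(nat \<times> nat \<Rightarrow> complex) cstar_algebra"

end

theory Submission
  imports Defs "HOL-Computational_Algebra.Fundamental_Theorem_Algebra"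
begin

text \<open>Applying \<open>F\<close> to a positive \<open>3 \<times> 3\<close> matrix \<open>(b\<^sub>i\<^sup>* b\<^sub>j)\<close> and factoring the result as
  \<open>Z\<^sup>* Z\<close> gives \<open>F (b\<^sup>* b) - F(b)\<^sup>* F(b) = \<Sum> w\<^sub>k\<^sup>* w\<^sub>k\<close> and
  \<open>F (d b) - F(d) F(b) = \<Sum> z\<^sub>k w\<^sub>k\<close> with the same \<open>w\<^sub>k\<close>. Hence \<open>F\<close> is multiplicative under \<open>\<omega>\<close>
  at every \<open>b\<close> at which the Kadison--Schwarz inequality is an equality under \<open>\<omega>\<close>; parts i to v
  follow. For the existence results, \<open>\<omega> (a F(b c)) = \<omega> (a F(c b))\<close> holds in both cases; decompose
  \<open>1\<close> into minimal projections \<open>q\<close> of \<open>B\<close> and put \<open>G(a) = \<Sum> \<omega> (a F(q)) / \<xi>(q) \<cdot> q\<close>, with the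
  coefficient \<open>\<omega>(a)\<close> where \<open>\<xi>(q) = 0\<close>. The counterexamples are the inclusion of the diagonal
  matrices into the \<open>2 \<times> 2\<close> matrices with a non-diagonal vector state, and the map
  \<open>b \<mapsto> diag (\<psi>\<^sub>1(b), \<psi>\<^sub>2(b))\<close> given by two non-commuting vector states \<open>\<psi>\<^sub>1, \<psi>\<^sub>2\<close> with the
  normalized trace: a Bayesian inverse is uniquely determined on suitable elements there and
  fails to preserve the involution.\<close>

section \<open>Star-algebras, linear maps and positive functionals\<close>

text \<open>Positivity means having a factorization y^* y, in A as well as in its matrix algebras,
  so every claim of complete positivity asks for an explicit factor. This is where Cholesky
  factorization comes from: a map into the span of orthogonal projections is a family of states,
  each state turns a Gram matrix over A into a positive semidefinite scalar matrix, and the scalar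
  factors reassemble to one factor over B. The formula for G is Bayes' rule: for G(a) = \<Sum> g_q
  q, the condition \<xi>(G(a) q) = \<omega>(a F(q)) reads g_q \<xi>(q) = \<omega>(a F(q)). Testing
  on the q is enough, since the symmetry in b and c gives \<omega>(a F(q b)) = \<omega>(a F(q b q))
  and q b q is a multiple of q by minimality. Commutativity of A makes each coefficient a positive
  functional of a. In both counterexamples \<xi> is faithful, so the Bayes condition leaves a single
  candidate for G(a). It breaks the involution because two matrices do not commute: the density of
  \<omega> with a diagonal matrix unit in one case, the densities of the two vector states in the
  other.\<close>

lemma complex_algebra_simps [simp]:
  "carrier complex_algebra = UNIV" "x \<otimes>\<^bsub>complex_algebra\<^esub> y = x * y"
  "\<one>\<^bsub>complex_algebra\<^esub> = 1" "\<zero>\<^bsub>complex_algebra\<^esub> = 0"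
  "x \<oplus>\<^bsub>complex_algebra\<^esub> y = x + y" "x \<odot>\<^bsub>complex_algebra\<^esub> y = x * y"
  "star complex_algebra x = cnj x"
  by (simp_all add: complex_algebra_def)

lemma positive_complex_algebra_iff: "positive complex_algebra z \<longleftrightarrow> z \<in> \<real>\<^sub>\<ge>\<^sub>0"
proof
  assume "positive complex_algebra z"
  then show "z \<in> \<real>\<^sub>\<ge>\<^sub>0"
    by (auto simp: positive_def complex_nonneg_Reals_iff)
next
  assume "z \<in> \<real>\<^sub>\<ge>\<^sub>0"
  then have "z = cnj (sqrt (Re z)) * sqrt (Re z)"
    by (auto simp: complex_nonneg_Reals_iff complex_eq_iff)
  then show "positive complex_algebra z"
    unfolding positive_def by (intro bexI[of _ "complex_of_real (sqrt (Re z))"]) auto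
qed

context star_algebra
begin

lemma smult_in_carrier [simp, intro]: "x \<in> carrier A \<Longrightarrow> c \<odot> x \<in> carrier A"
  using smult_closed by simp

lemma smult_add_left: "x \<in> carrier A \<Longrightarrow> (c + d) \<odot> x = c \<odot> x \<oplus> d \<odot> x"
  using smult_l_distr by simp

lemma smult_add_right:
  "x \<in> carrier A \<Longrightarrow> y \<in> carrier A \<Longrightarrow> c \<odot> (x \<oplus> y) = c \<odot> x \<oplus> c \<odot> y"
  using smult_r_distr by simp

lemma smult_smult: "x \<in> carrier A \<Longrightarrow> c \<odot> (d \<odot> x) = (c * d) \<odot> x"
  using smult_assoc1 by simp

lemma one_smult [simp]: "x \<in> carrier A \<Longrightarrow> 1 \<odot> x = x"
  using smult_one by simp

lemma zero_smult [simp]: "x \<in> carrier A \<Longrightarrow> 0 \<odot> x = \<zero>"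
  using smult_l_null by simp

lemma smult_zero [simp]: "c \<odot> \<zero> = \<zero>"
  using smult_r_null by simp

lemma minus_smult: "x \<in> carrier A \<Longrightarrow> (- c) \<odot> x = \<ominus> (c \<odot> x)"
  by (metis smult_add_left zero_smult add.inv_equality smult_in_carrier add.left_inverse)

lemma smult_finsum:
  "finite J \<Longrightarrow> f \<in> J \<rightarrow> carrier A \<Longrightarrow> c \<odot> (\<Oplus>j\<in>J. f j) = (\<Oplus>j\<in>J. c \<odot> f j)"
  by (induction J rule: finite_induct) (auto simp: smult_add_right Pi_def)

declare star_closed [simp, intro] star_star [simp]

lemma star_zero [simp]: "star A \<zero> = \<zero>"
  by (metis smult_zero star_smult zero_closed zero_smult complex_cnj_zero star_closed)

lemma star_one [simp]: "star A \<one> = \<one>"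
  by (metis l_one one_closed r_one star_closed star_mult star_star)

lemma star_uminus: "x \<in> carrier A \<Longrightarrow> star A (\<ominus> x) = \<ominus> star A x"
  by (metis a_inv_closed star_add star_closed star_zero l_neg minus_equality)

lemma star_finsum:
  "finite J \<Longrightarrow> f \<in> J \<rightarrow> carrier A \<Longrightarrow> star A (\<Oplus>j\<in>J. f j) = (\<Oplus>j\<in>J. star A (f j))"
  by (induction J rule: finite_induct) (auto simp: star_add Pi_def)

lemma finsum_swap:
  assumes "finite I" "finite J" "\<And>i j. i \<in> I \<Longrightarrow> j \<in> J \<Longrightarrow> f i j \<in> carrier A"
  shows "(\<Oplus>i\<in>I. \<Oplus>j\<in>J. f i j) = (\<Oplus>j\<in>J. \<Oplus>i\<in>I. f i j)"
  using assms(1,3)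
proof (induction I rule: finite_induct)
  case (insert i I)
  then have "(\<Oplus>i\<in>insert i I. \<Oplus>j\<in>J. f i j) = (\<Oplus>j\<in>J. f i j) \<oplus> (\<Oplus>j\<in>J. \<Oplus>i\<in>I. f i j)"
    by (subst finsum_insert) (auto intro!: finsum_closed)
  also have "\<dots> = (\<Oplus>j\<in>J. f i j \<oplus> (\<Oplus>i\<in>I. f i j))"
    using insert.prems by (subst finsum_addf) (auto intro!: finsum_closed)
  also have "\<dots> = (\<Oplus>j\<in>J. \<Oplus>i\<in>insert i I. f i j)"
    using insert by (intro finsum_cong') (auto intro!: finsum_closed)
  finally show ?case .
qed simp

end

lemma linear_map_add:
  "linear_map A B F \<Longrightarrow> x \<in> carrier A \<Longrightarrow> y \<in> carrier A \<Longrightarrow>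
    F (x \<oplus>\<^bsub>A\<^esub> y) = F x \<oplus>\<^bsub>B\<^esub> F y"
  and linear_map_smult:
  "linear_map A B F \<Longrightarrow> x \<in> carrier A \<Longrightarrow> F (c \<odot>\<^bsub>A\<^esub> x) = c \<odot>\<^bsub>B\<^esub> F x"
  and linear_map_closed: "linear_map A B F \<Longrightarrow> x \<in> carrier A \<Longrightarrow> F x \<in> carrier B"
  unfolding linear_map_def by auto

lemma linear_map_zero:
  assumes "star_algebra A" "star_algebra B" "linear_map A B F"
  shows "F \<zero>\<^bsub>A\<^esub> = \<zero>\<^bsub>B\<^esub>"
proof -
  interpret A: star_algebra A by fact
  interpret B: star_algebra B by fact
  show ?thesis
    using linear_map_smult[OF assms(3) A.zero_closed, of 0] linear_map_closed[OF assms(3) A.zero_closed]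
    by simp
qed

lemma linear_map_finsum:
  assumes "star_algebra A" "star_algebra B" "linear_map A B F" "finite J" "f \<in> J \<rightarrow> carrier A"
  shows "F (\<Oplus>\<^bsub>A\<^esub>j\<in>J. f j) = (\<Oplus>\<^bsub>B\<^esub>j\<in>J. F (f j))"
proof -
  interpret A: star_algebra A by fact
  interpret B: star_algebra B by fact
  show ?thesis
    using assms(4,5)
  proof (induction J rule: finite_induct)
    case empty
    then show ?case using linear_map_zero[OF assms(1-3)] by simp
  next
    case (insert j J)
    then show ?case
      by (auto simp: linear_map_add[OF assms(3)] Pi_def linear_map_closed[OF assms(3)])
  qed
qed

lemma linear_map_comp:
  assumes "linear_map A B F" "linear_map B C G"
  shows "linear_map A C (G \<circ> F)"
  using assms unfolding linear_map_def Pi_def by auto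

definition linear_functional :: "('a, 'm) star_algebra_scheme \<Rightarrow> ('a \<Rightarrow> complex) \<Rightarrow> bool" where
  "linear_functional A \<phi> \<longleftrightarrow> linear_map A complex_algebra \<phi>"

context star_algebra
begin

context
  fixes \<phi> assumes \<phi>: "linear_functional A \<phi>"
begin

lemma functional_add:
  "x \<in> carrier A \<Longrightarrow> y \<in> carrier A \<Longrightarrow> \<phi> (x \<oplus> y) = \<phi> x + \<phi> y"
  and functional_smult: "x \<in> carrier A \<Longrightarrow> \<phi> (c \<odot> x) = c * \<phi> x"
  using \<phi> unfolding linear_functional_def linear_map_def by auto

lemma functional_zero: "\<phi> \<zero> = 0"
  using functional_smult[of \<zero> 0] by simp

lemma functional_finsum:
  "finite J \<Longrightarrow> f \<in> J \<rightarrow> carrier A \<Longrightarrow> \<phi> (\<Oplus>j\<in>J. f j) = (\<Sum>j\<in>J. \<phi> (f j))"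
  by (induction J rule: finite_induct) (auto simp: functional_zero functional_add Pi_def)

end

end

text \<open>Not normalized, because the results below are also applied to functionals such as x
  \<mapsto> \<omega>(a^* a x).\<close>

definition positive_functional :: "('a, 'm) star_algebra_scheme \<Rightarrow> ('a \<Rightarrow> complex) \<Rightarrow> bool" where
  "positive_functional A \<phi> \<longleftrightarrow>
     linear_functional A \<phi> \<and> (\<forall>x\<in>carrier A. \<phi> (star A x \<otimes>\<^bsub>A\<^esub> x) \<in> \<real>\<^sub>\<ge>\<^sub>0)"

lemma state_iff: "state A \<omega> \<longleftrightarrow> positive_functional A \<omega> \<and> \<omega> \<one>\<^bsub>A\<^esub> = 1"
  unfolding state_def positive_map_def positive_functional_def linear_functional_def
    positive_complex_algebra_iff
  by (auto simp: positive_def)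

lemma nonneg_quadratic_imp_zero:
  fixes p s :: complex
  assumes "\<And>t. Re (p + t * s + cnj (t * s)) \<ge> 0"
  shows "s = 0"
proof (rule ccontr)
  assume "s \<noteq> 0"
  then have pos: "(cmod s)\<^sup>2 > 0"
    by simp
  \<comment> \<open>For t = - r cnj(s) the expression is Re p - 2 r |s|^2. This r makes it Re p - 2
    (|Re p| + 1), which is negative.\<close>
  define r where "r = (\<bar>Re p\<bar> + 1) / (cmod s)\<^sup>2"
  have "Re (p + (- of_real r * cnj s) * s + cnj ((- of_real r * cnj s) * s)) =
      Re p - 2 * r * (cmod s)\<^sup>2"
    unfolding cmod_power2 by (simp add: power2_eq_square algebra_simps)
  also have "r * (cmod s)\<^sup>2 = \<bar>Re p\<bar> + 1"
    using pos by (simp add: r_def)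
  then have "Re p - 2 * r * (cmod s)\<^sup>2 < 0"
    by (simp add: mult.assoc)
  finally show False
    using assms by (metis not_less)
qed

context star_algebra
begin

context
  fixes \<phi> assumes \<phi>: "positive_functional A \<phi>"
begin

private lemma lin: "linear_functional A \<phi>"
  using \<phi> by (simp add: positive_functional_def)

text \<open>The value of \<phi> at (x + t y)^* (x + t y), expanded in t. Particular choices of t
  then give hermitian symmetry and the null case of Cauchy--Schwarz.\<close>

lemma positive_functional_expand:
  assumes "x \<in> carrier A" "y \<in> carrier A"
  shows "\<phi> (star A x \<otimes> x) + t * \<phi> (star A x \<otimes> y) + cnj t * \<phi> (star A y \<otimes> x)
    + t * cnj t * \<phi> (star A y \<otimes> y) \<in> \<real>\<^sub>\<ge>\<^sub>0"
proof -
  have "star A (x \<oplus> t \<odot> y) \<otimes> (x \<oplus> t \<odot> y) =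
      star A x \<otimes> x \<oplus> t \<odot> (star A x \<otimes> y) \<oplus> (cnj t \<odot> (star A y \<otimes> x) \<oplus> (t * cnj t) \<odot> (star A y \<otimes> y))"
    using assms
    by (simp add: star_add star_smult l_distr r_distr smult_mult_left smult_mult_right smult_smult
        smult_add_right a_ac)
  then have "\<phi> (star A (x \<oplus> t \<odot> y) \<otimes> (x \<oplus> t \<odot> y)) =
      \<phi> (star A x \<otimes> x) + t * \<phi> (star A x \<otimes> y) + cnj t * \<phi> (star A y \<otimes> x)
      + t * cnj t * \<phi> (star A y \<otimes> y)"
    using assms by (simp add: functional_add[OF lin] functional_smult[OF lin])
  moreover have "\<phi> (star A (x \<oplus> t \<odot> y) \<otimes> (x \<oplus> t \<odot> y)) \<in> \<real>\<^sub>\<ge>\<^sub>0"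
    using \<phi> assms by (simp add: positive_functional_def)
  ultimately show ?thesis
    by simp
qed

lemma functional_star_mult:
  assumes "x \<in> carrier A" "y \<in> carrier A"
  shows "\<phi> (star A y \<otimes> x) = cnj (\<phi> (star A x \<otimes> y))"
proof -
  have "\<phi> (star A x \<otimes> x) \<in> \<real>\<^sub>\<ge>\<^sub>0" "\<phi> (star A y \<otimes> y) \<in> \<real>\<^sub>\<ge>\<^sub>0"
    using \<phi> assms by (auto simp: positive_functional_def)
  \<comment> \<open>Write s and s' for the two mixed values. t = 1 makes s + s' real and t = \<i>
    makes \<i> (s - s') real; together s' = cnj s.\<close>
  then show ?thesis
    using positive_functional_expand[OF assms, of 1] positive_functional_expand[OF assms, of \<i>]
    by (auto simp: complex_nonneg_Reals_iff complex_eq_iff)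
qed

lemma functional_star: "x \<in> carrier A \<Longrightarrow> \<phi> (star A x) = cnj (\<phi> x)"
  using functional_star_mult[of \<one> x] by simp

text \<open>Without its |t|^2 term the nonnegative expansion is affine in t, so its linear
  coefficient must vanish.\<close>

lemma functional_null:
  assumes "x \<in> carrier A" "y \<in> carrier A" "\<phi> (star A x \<otimes> x) = 0"
  shows "\<phi> (y \<otimes> x) = 0"
proof -
  have "\<phi> (star A (star A y) \<otimes> x) = 0"
  proof (rule nonneg_quadratic_imp_zero)
    fix t
    show "Re (\<phi> (star A (star A y) \<otimes> star A y) + t * \<phi> (star A (star A y) \<otimes> x)
        + cnj (t * \<phi> (star A (star A y) \<otimes> x))) \<ge> 0"
      using positive_functional_expand[of "star A y" x t] functional_star_mult[of "star A y" x] assms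
      by (simp add: complex_nonneg_Reals_iff)
  qed
  then show ?thesis
    using assms by simp
qed

end

end

section \<open>The Kadison--Schwarz defect\<close>

lemma (in abelian_group) eq_add_diff:
  "x \<in> carrier G \<Longrightarrow> y \<in> carrier G \<Longrightarrow> x = y \<oplus> (x \<ominus> y)"
  by (simp add: a_minus_def a_lcomm r_neg)

lemma (in star_algebra) positive_mat_algebra_iff:
  "positive (mat_algebra n A) x \<longleftrightarrow>
     (\<exists>y\<in>{..<n} \<times> {..<n} \<rightarrow>\<^sub>E carrier A.
        x = (\<lambda>(i, j)\<in>{..<n} \<times> {..<n}. \<Oplus>k\<in>{..<n}. star A (y (k, i)) \<otimes> y (k, j)))"
proof -
  let ?I = "{..<n} \<times> {..<n}"
  have "(\<lambda>(i, j)\<in>?I. \<Oplus>k\<in>{..<n}. (\<lambda>(i, j)\<in>?I. star A (y (j, i))) (i, k) \<otimes> y (k, j)) =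
      (\<lambda>(i, j)\<in>?I. \<Oplus>k\<in>{..<n}. star A (y (k, i)) \<otimes> y (k, j))"
    if "y \<in> ?I \<rightarrow>\<^sub>E carrier A" for y
  proof (intro restrict_ext, clarify)
    fix i j assume ij: "i < n" "j < n"
    have y: "y (k, l) \<in> carrier A" if "k < n" "l < n" for k l
      using PiE_mem[OF \<open>y \<in> ?I \<rightarrow>\<^sub>E carrier A\<close>] that by auto
    show "(\<Oplus>k\<in>{..<n}. (\<lambda>(i, j)\<in>?I. star A (y (j, i))) (i, k) \<otimes> y (k, j)) =
      (\<Oplus>k\<in>{..<n}. star A (y (k, i)) \<otimes> y (k, j))"
      using y ij by (intro finsum_cong') auto
  qed
  then show ?thesis
    by (auto simp: positive_def mat_algebra_def Let_def)
qed

text \<open>The matrix with entries \<open>b\<^sub>i\<^sup>* b\<^sub>j\<close> is positive, hence so is its image.\<close>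

lemma cpu_map_gram_matrix:
  fixes b :: "nat \<Rightarrow> 'b"
  assumes "star_algebra B" "star_algebra A" "cpu_map B A F" "b \<in> {..<n} \<rightarrow> carrier B" "n \<ge> 1"
  shows "\<exists>Z. (\<forall>k<n. \<forall>i<n. Z k i \<in> carrier A) \<and>
    (\<forall>i<n. \<forall>j<n. F (star B (b i) \<otimes>\<^bsub>B\<^esub> b j) = (\<Oplus>\<^bsub>A\<^esub>k\<in>{..<n}. star A (Z k i) \<otimes>\<^bsub>A\<^esub> Z k j))"
proof -
  interpret A: star_algebra A by fact
  interpret B: star_algebra B by fact
  let ?I = "{..<n} \<times> {..<n}"
  \<comment> \<open>The b's form row 0 and all other rows vanish, so y^* y is the Gram matrix of the
    b's, written with a square factor.\<close>
  define y where "y = (\<lambda>(k, i)\<in>?I. if k = 0 then b i else \<zero>\<^bsub>B\<^esub>)"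
  have b: "b i \<in> carrier B" if "i < n" for i
    using assms(4) that by auto
  have y: "y \<in> ?I \<rightarrow>\<^sub>E carrier B"
    using b by (auto simp: y_def)
  have sum: "(\<Oplus>\<^bsub>B\<^esub>k\<in>{..<n}. star B (y (k, i)) \<otimes>\<^bsub>B\<^esub> y (k, j)) = star B (b i) \<otimes>\<^bsub>B\<^esub> b j"
    if "i < n" "j < n" for i j
  proof -
    have "(\<Oplus>\<^bsub>B\<^esub>k\<in>{..<n}. star B (y (k, i)) \<otimes>\<^bsub>B\<^esub> y (k, j)) =
        (\<Oplus>\<^bsub>B\<^esub>k\<in>{..<n}. if 0 = k then (\<lambda>_. star B (b i) \<otimes>\<^bsub>B\<^esub> b j) k else \<zero>\<^bsub>B\<^esub>)"
      using that b by (intro B.finsum_cong') (auto simp: y_def)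
    also have "\<dots> = star B (b i) \<otimes>\<^bsub>B\<^esub> b j"
      using that b assms(5) by (intro B.finsum_singleton) auto
    finally show ?thesis .
  qed
  let ?x = "\<lambda>(i, j)\<in>?I. \<Oplus>\<^bsub>B\<^esub>k\<in>{..<n}. star B (y (k, i)) \<otimes>\<^bsub>B\<^esub> y (k, j)"
  have "positive (mat_algebra n B) ?x"
    using y by (auto simp: B.positive_mat_algebra_iff)
  then have "positive (mat_algebra n A) (amplify n F ?x)"
    using assms(3,5) by (auto simp: cpu_map_def positive_map_def)
  then obtain z where z: "z \<in> ?I \<rightarrow>\<^sub>E carrier A"
    "amplify n F ?x = (\<lambda>(i, j)\<in>?I. \<Oplus>\<^bsub>A\<^esub>k\<in>{..<n}. star A (z (k, i)) \<otimes>\<^bsub>A\<^esub> z (k, j))"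
    by (auto simp: A.positive_mat_algebra_iff)
  show ?thesis
  proof (intro exI[of _ "\<lambda>k i. z (k, i)"] conjI allI impI)
    fix i j assume ij: "i < n" "j < n"
    have "amplify n F ?x (i, j) = F (star B (b i) \<otimes>\<^bsub>B\<^esub> b j)"
      using ij sum by (simp add: amplify_def)
    then show "F (star B (b i) \<otimes>\<^bsub>B\<^esub> b j) = (\<Oplus>\<^bsub>A\<^esub>k\<in>{..<n}. star A (z (k, i)) \<otimes>\<^bsub>A\<^esub> z (k, j))"
      using ij by (simp add: z(2))
  qed (use z(1) in auto)
qed

text \<open>The target comes first: a map G from A to B is an instance
  \<open>cpu B A G\<close>.\<close>

locale cpu = A: star_algebra A + B: star_algebra B
  for A :: "('a, 'm) star_algebra_scheme" and B :: "('b, 'n) star_algebra_scheme" +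
  fixes F :: "'b \<Rightarrow> 'a"
  assumes cpu_map: "cpu_map B A F"
begin

lemma linear: "linear_map B A F" and unit [simp]: "F \<one>\<^bsub>B\<^esub> = \<one>\<^bsub>A\<^esub>"
  using cpu_map by (auto simp: cpu_map_def)

lemma closed [simp, intro]: "b \<in> carrier B \<Longrightarrow> F b \<in> carrier A"
  using linear by (rule linear_map_closed)

text \<open>The image of the Gram matrix of (1, b) has the form Z^* Z, hence is hermitian, and its
  two off-diagonal entries are F(b) and F(star b).\<close>

lemma star_preserving:
  assumes "b \<in> carrier B"
  shows "F (star B b) = star A (F b)"
proof -
  let ?b = "\<lambda>i::nat. if i = 0 then \<one>\<^bsub>B\<^esub> else b"
  have "?b \<in> {..<2} \<rightarrow> carrier B"
    using assms by auto
  from cpu_map_gram_matrix[OF B.star_algebra_axioms A.star_algebra_axioms cpu_map this one_le_numeral]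
  obtain Z where "\<forall>k<2::nat. \<forall>i<2. Z k i \<in> carrier A"
    "\<forall>i<2. \<forall>j<2. F (star B (?b i) \<otimes>\<^bsub>B\<^esub> ?b j) = (\<Oplus>\<^bsub>A\<^esub>k\<in>{..<2}. star A (Z k i) \<otimes>\<^bsub>A\<^esub> Z k j)"
    by blast
  note Z = this[rule_format]
  have "F (star B b) = (\<Oplus>\<^bsub>A\<^esub>k\<in>{..<2}. star A (Z k 1) \<otimes>\<^bsub>A\<^esub> Z k 0)"
    using Z(2)[of 1 0] assms by simp
  also have "\<dots> = (\<Oplus>\<^bsub>A\<^esub>k\<in>{..<2}. star A (star A (Z k 0) \<otimes>\<^bsub>A\<^esub> Z k 1))"
    using Z(1) by (intro A.finsum_cong') (auto simp: A.star_mult)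
  also have "\<dots> = star A (\<Oplus>\<^bsub>A\<^esub>k\<in>{..<2}. star A (Z k 0) \<otimes>\<^bsub>A\<^esub> Z k 1)"
    using Z(1) by (intro A.star_finsum[symmetric]) auto
  also have "\<dots> = star A (F b)"
    using Z(2)[of 0 1] assms by simp
  finally show ?thesis .
qed

text \<open>Treat the columns of Z as vectors with an A-valued inner product. Column 0 has square
  F(1) = 1, so w = Z_1 - Z_0 F(b) is the component of column 1 orthogonal to column 0. Its inner
  products with columns 1 and 2 are the two defects, and its inner product with itself equals the
  one with column 1.\<close>

lemma schwarz_defect:
  assumes "b \<in> carrier B" "d \<in> carrier B"
  shows "\<exists>w z. (\<forall>k<3::nat. w k \<in> carrier A) \<and> (\<forall>k<3. z k \<in> carrier A) \<and>
    F (star B b \<otimes>\<^bsub>B\<^esub> b) = star A (F b) \<otimes>\<^bsub>A\<^esub> F b \<oplus>\<^bsub>A\<^esub> (\<Oplus>\<^bsub>A\<^esub>k\<in>{..<3}. star A (w k) \<otimes>\<^bsub>A\<^esub> w k) \<and>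
    F (d \<otimes>\<^bsub>B\<^esub> b) = F d \<otimes>\<^bsub>A\<^esub> F b \<oplus>\<^bsub>A\<^esub> (\<Oplus>\<^bsub>A\<^esub>k\<in>{..<3}. z k \<otimes>\<^bsub>A\<^esub> w k)"
proof -
  \<comment> \<open>The third entry is the adjoint of d, so that the Gram entries (2, 0) and (2, 1)
    are d and d b.\<close>
  let ?b = "\<lambda>i::nat. if i = 0 then \<one>\<^bsub>B\<^esub> else if i = 1 then b else star B d"
  have "?b \<in> {..<3} \<rightarrow> carrier B"
    using assms by auto
  from cpu_map_gram_matrix[OF B.star_algebra_axioms A.star_algebra_axioms cpu_map this one_le_numeral]
  obtain Z where "\<forall>k<3::nat. \<forall>i<3. Z k i \<in> carrier A"
    "\<forall>i<3. \<forall>j<3. F (star B (?b i) \<otimes>\<^bsub>B\<^esub> ?b j) = (\<Oplus>\<^bsub>A\<^esub>k\<in>{..<3}. star A (Z k i) \<otimes>\<^bsub>A\<^esub> Z k j)"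
    by blast
  note Z = this[rule_format]
  define M where "M = (\<lambda>i j. \<Oplus>\<^bsub>A\<^esub>k\<in>{..<3}. star A (Z k i) \<otimes>\<^bsub>A\<^esub> Z k j)"
  define w where "w k = Z k 1 \<ominus>\<^bsub>A\<^esub> Z k 0 \<otimes>\<^bsub>A\<^esub> F b" for k
  have F: "F b \<in> carrier A" "F d \<in> carrier A"
    using assms by auto
  have M: "M 0 0 = \<one>\<^bsub>A\<^esub>" "M 0 1 = F b" "M 1 1 = F (star B b \<otimes>\<^bsub>B\<^esub> b)" "M 1 0 = star A (F b)"
    "M 2 0 = F d" "M 2 1 = F (d \<otimes>\<^bsub>B\<^esub> b)"
    using assms Z(2)[of 0 0] Z(2)[of 0 1] Z(2)[of 1 1] Z(2)[of 1 0] Z(2)[of 2 0] Z(2)[of 2 1]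
    by (simp_all add: M_def star_preserving)
  have w: "w k \<in> carrier A" if "k < 3" for k
    using Z(1) that F by (simp add: w_def)
  have row: "(\<Oplus>\<^bsub>A\<^esub>k\<in>{..<3}. star A (Z k i) \<otimes>\<^bsub>A\<^esub> w k) = M i 1 \<ominus>\<^bsub>A\<^esub> M i 0 \<otimes>\<^bsub>A\<^esub> F b" if "i < 3" for i
  proof -
    have "M i 1 \<ominus>\<^bsub>A\<^esub> M i 0 \<otimes>\<^bsub>A\<^esub> F b = M i 1 \<oplus>\<^bsub>A\<^esub> M i 0 \<otimes>\<^bsub>A\<^esub> (\<ominus>\<^bsub>A\<^esub> F b)"
      using Z(1) that F unfolding M_def
      by (subst A.r_minus) (auto intro!: A.finsum_closed simp: a_minus_def)
    also have "\<dots> = (\<Oplus>\<^bsub>A\<^esub>k\<in>{..<3}. star A (Z k i) \<otimes>\<^bsub>A\<^esub> Z k 1 \<oplus>\<^bsub>A\<^esub> star A (Z k i) \<otimes>\<^bsub>A\<^esub> Z k 0 \<otimes>\<^bsub>A\<^esub> (\<ominus>\<^bsub>A\<^esub> F b))"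
      unfolding M_def using Z(1) that F
      by (subst A.finsum_ldistr, simp, simp, force, subst A.finsum_addf) auto
    also have "\<dots> = (\<Oplus>\<^bsub>A\<^esub>k\<in>{..<3}. star A (Z k i) \<otimes>\<^bsub>A\<^esub> w k)"
      using Z(1) that F by (intro A.finsum_cong')
        (auto simp: w_def a_minus_def A.r_distr A.m_assoc A.r_minus)
    finally show ?thesis ..
  qed
  have defect: "F (star B b \<otimes>\<^bsub>B\<^esub> b) \<ominus>\<^bsub>A\<^esub> star A (F b) \<otimes>\<^bsub>A\<^esub> F b =
      (\<Oplus>\<^bsub>A\<^esub>k\<in>{..<3}. star A (w k) \<otimes>\<^bsub>A\<^esub> w k)"
  proof -
    have "(\<Oplus>\<^bsub>A\<^esub>k\<in>{..<3}. star A (w k) \<otimes>\<^bsub>A\<^esub> w k) =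
        (\<Oplus>\<^bsub>A\<^esub>k\<in>{..<3}. star A (Z k 1) \<otimes>\<^bsub>A\<^esub> w k \<oplus>\<^bsub>A\<^esub> (\<ominus>\<^bsub>A\<^esub> star A (F b)) \<otimes>\<^bsub>A\<^esub> (star A (Z k 0) \<otimes>\<^bsub>A\<^esub> w k))"
    proof (intro A.finsum_cong')
      fix k :: nat assume k: "k \<in> {..<3}"
      then have "star A (w k) = star A (Z k 1) \<oplus>\<^bsub>A\<^esub> (\<ominus>\<^bsub>A\<^esub> star A (F b)) \<otimes>\<^bsub>A\<^esub> star A (Z k 0)"
        using Z(1) F
        by (auto simp: w_def a_minus_def A.star_add A.star_mult A.star_uminus A.l_minus)
      then show "star A (w k) \<otimes>\<^bsub>A\<^esub> w k =
          star A (Z k 1) \<otimes>\<^bsub>A\<^esub> w k \<oplus>\<^bsub>A\<^esub> (\<ominus>\<^bsub>A\<^esub> star A (F b)) \<otimes>\<^bsub>A\<^esub> (star A (Z k 0) \<otimes>\<^bsub>A\<^esub> w k)"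
        using k Z(1) F w by (simp add: A.l_distr A.m_assoc)
    qed (use Z(1) F w in auto)
    also have "\<dots> = (\<Oplus>\<^bsub>A\<^esub>k\<in>{..<3}. star A (Z k 1) \<otimes>\<^bsub>A\<^esub> w k) \<oplus>\<^bsub>A\<^esub>
        (\<ominus>\<^bsub>A\<^esub> star A (F b)) \<otimes>\<^bsub>A\<^esub> (\<Oplus>\<^bsub>A\<^esub>k\<in>{..<3}. star A (Z k 0) \<otimes>\<^bsub>A\<^esub> w k)"
      using Z(1) F w
      by (subst A.finsum_rdistr, simp, simp, force, subst A.finsum_addf) auto
    \<comment> \<open>Orthogonality to column 0: by \<open>row\<close> this is F(b) - 1
      F(b).\<close>
    also have "(\<Oplus>\<^bsub>A\<^esub>k\<in>{..<3}. star A (Z k 0) \<otimes>\<^bsub>A\<^esub> w k) = \<zero>\<^bsub>A\<^esub>"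
      using row[of 0] F by (simp add: M del: One_nat_def)
    finally show ?thesis
      using row[of 1] F assms by (simp add: M del: One_nat_def)
  qed
  show ?thesis
  proof (rule exI[of _ w], rule exI[of _ "\<lambda>k. star A (Z k 2)"], intro conjI)
    have "(\<Oplus>\<^bsub>A\<^esub>k\<in>{..<3}. star A (w k) \<otimes>\<^bsub>A\<^esub> w k) \<in> carrier A"
      using w by (intro A.finsum_closed) auto
    then show "F (star B b \<otimes>\<^bsub>B\<^esub> b) =
        star A (F b) \<otimes>\<^bsub>A\<^esub> F b \<oplus>\<^bsub>A\<^esub> (\<Oplus>\<^bsub>A\<^esub>k\<in>{..<3}. star A (w k) \<otimes>\<^bsub>A\<^esub> w k)"
      using F assms unfolding defect[symmetric] by (intro A.eq_add_diff) auto
    show "F (d \<otimes>\<^bsub>B\<^esub> b) = F d \<otimes>\<^bsub>A\<^esub> F b \<oplus>\<^bsub>A\<^esub> (\<Oplus>\<^bsub>A\<^esub>k\<in>{..<3}. star A (Z k 2) \<otimes>\<^bsub>A\<^esub> w k)"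
      using F assms A.eq_add_diff[of "F (d \<otimes>\<^bsub>B\<^esub> b)" "F d \<otimes>\<^bsub>A\<^esub> F b"] row[of 2] by (simp add: M del: One_nat_def)
  qed (use w Z(1) in auto)
qed

context
  fixes \<omega> assumes \<omega>: "positive_functional A \<omega>"
begin

private lemma lin: "linear_functional A \<omega>"
  using \<omega> by (simp add: positive_functional_def)

lemma positive_functional_comp: "positive_functional B (\<omega> \<circ> F)"
proof -
  have "linear_functional B (\<omega> \<circ> F)"
    using linear lin unfolding linear_functional_def by (rule linear_map_comp)
  moreover have "\<omega> (F (star B b \<otimes>\<^bsub>B\<^esub> b)) \<in> \<real>\<^sub>\<ge>\<^sub>0" if b: "b \<in> carrier B" for b
  proof -
    obtain w where w: "\<And>k. k < (3::nat) \<Longrightarrow> w k \<in> carrier A"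
      "F (star B b \<otimes>\<^bsub>B\<^esub> b) = star A (F b) \<otimes>\<^bsub>A\<^esub> F b \<oplus>\<^bsub>A\<^esub> (\<Oplus>\<^bsub>A\<^esub>k\<in>{..<3}. star A (w k) \<otimes>\<^bsub>A\<^esub> w k)"
      using schwarz_defect[OF b b] by blast
    have "\<omega> (F (star B b \<otimes>\<^bsub>B\<^esub> b)) =
        \<omega> (star A (F b) \<otimes>\<^bsub>A\<^esub> F b) + (\<Sum>k<3. \<omega> (star A (w k) \<otimes>\<^bsub>A\<^esub> w k))"
      using w(1) b unfolding w(2)
      by (subst A.functional_add[OF lin]) (auto intro!: A.finsum_closed simp: A.functional_finsum[OF lin])
    also have "\<dots> \<in> \<real>\<^sub>\<ge>\<^sub>0"
      using \<omega> w(1) b unfolding positive_functional_def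
      by (intro nonneg_Reals_add_I) (auto simp: numeral_3_eq_3)
    finally show ?thesis .
  qed
  ultimately show ?thesis
    by (simp add: positive_functional_def)
qed

text \<open>A functional version of the multiplicative domain argument: equality makes the sum of
  the nonnegative \<omega>(w_k^* w_k) vanish, so each term is zero, and
  \<open>functional_null\<close> then kills every \<omega>(a z_k w_k).\<close>

lemma schwarz:
  assumes "b \<in> carrier B"
  shows "\<omega> (F (star B b \<otimes>\<^bsub>B\<^esub> b)) - \<omega> (star A (F b) \<otimes>\<^bsub>A\<^esub> F b) \<in> \<real>\<^sub>\<ge>\<^sub>0" (is ?nonneg)
    and "\<omega> (F (star B b \<otimes>\<^bsub>B\<^esub> b)) = \<omega> (star A (F b) \<otimes>\<^bsub>A\<^esub> F b) \<Longrightarrow> a \<in> carrier A \<Longrightarrow>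
      d \<in> carrier B \<Longrightarrow> \<omega> (a \<otimes>\<^bsub>A\<^esub> F d \<otimes>\<^bsub>A\<^esub> F b) = \<omega> (a \<otimes>\<^bsub>A\<^esub> F (d \<otimes>\<^bsub>B\<^esub> b))"
      (is "?eq \<Longrightarrow> _ \<Longrightarrow> _ \<Longrightarrow> ?mult d")
proof -
  \<comment> \<open>Both claims are proved for a fixed d because the w's come from a factorization
    that involves d. The first claim is later read off with d = b.\<close>
  have *: "?nonneg \<and> (?eq \<longrightarrow> a \<in> carrier A \<longrightarrow> ?mult d)" if d: "d \<in> carrier B" for d
  proof -
    obtain w z where wz: "\<And>k. k < (3::nat) \<Longrightarrow> w k \<in> carrier A" "\<And>k. k < 3 \<Longrightarrow> z k \<in> carrier A"
      "F (star B b \<otimes>\<^bsub>B\<^esub> b) = star A (F b) \<otimes>\<^bsub>A\<^esub> F b \<oplus>\<^bsub>A\<^esub> (\<Oplus>\<^bsub>A\<^esub>k\<in>{..<3}. star A (w k) \<otimes>\<^bsub>A\<^esub> w k)"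
      "F (d \<otimes>\<^bsub>B\<^esub> b) = F d \<otimes>\<^bsub>A\<^esub> F b \<oplus>\<^bsub>A\<^esub> (\<Oplus>\<^bsub>A\<^esub>k\<in>{..<3}. z k \<otimes>\<^bsub>A\<^esub> w k)"
      using schwarz_defect[OF assms d] by blast
    have eq: "\<omega> (F (star B b \<otimes>\<^bsub>B\<^esub> b)) - \<omega> (star A (F b) \<otimes>\<^bsub>A\<^esub> F b) =
        (\<Sum>k<3. \<omega> (star A (w k) \<otimes>\<^bsub>A\<^esub> w k))"
      using wz(1) assms unfolding wz(3)
      by (subst A.functional_add[OF lin]) (auto intro!: A.finsum_closed simp: A.functional_finsum[OF lin])
    have pos: "\<omega> (star A (w k) \<otimes>\<^bsub>A\<^esub> w k) \<in> \<real>\<^sub>\<ge>\<^sub>0" if "k < 3" for k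
      using \<omega> wz(1) that by (auto simp: positive_functional_def)
    have ?nonneg
      unfolding eq using pos by (auto simp: numeral_3_eq_3)
    moreover have "?mult d" if ?eq and a: "a \<in> carrier A"
    proof -
      have sum0: "\<omega> (star A (w 0) \<otimes>\<^bsub>A\<^esub> w 0) + \<omega> (star A (w 1) \<otimes>\<^bsub>A\<^esub> w 1) + \<omega> (star A (w 2) \<otimes>\<^bsub>A\<^esub> w 2) = 0"
        using eq \<open>?eq\<close> by (simp add: numeral_3_eq_3 numeral_2_eq_2)
      have "\<omega> (star A (w k) \<otimes>\<^bsub>A\<^esub> w k) = 0" if "k < 3" for k
      proof -
        have "k = 0 \<or> k = 1 \<or> k = 2"
          using that by auto
        then show ?thesis
          using sum0 pos[of 0] pos[of 1] pos[of 2]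
          by (auto simp: complex_nonneg_Reals_iff complex_eq_iff)
      qed
      then have null: "\<omega> (a \<otimes>\<^bsub>A\<^esub> (z k \<otimes>\<^bsub>A\<^esub> w k)) = 0" if "k < 3" for k
        using A.functional_null[OF \<omega>, of "w k" "a \<otimes>\<^bsub>A\<^esub> z k"] wz(1,2) a that by (simp add: A.m_assoc)
      have "\<omega> (a \<otimes>\<^bsub>A\<^esub> (\<Oplus>\<^bsub>A\<^esub>k\<in>{..<3}. z k \<otimes>\<^bsub>A\<^esub> w k)) = (\<Sum>k<3. \<omega> (a \<otimes>\<^bsub>A\<^esub> (z k \<otimes>\<^bsub>A\<^esub> w k)))"
        using wz(1,2) a by (subst A.finsum_rdistr) (auto simp: A.functional_finsum[OF lin])
      also have "\<dots> = 0"
        using null by simp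
      finally show ?thesis
        using a wz(1,2) assms d unfolding wz(4)
        by (subst A.r_distr) (auto intro!: A.finsum_closed simp: A.functional_add[OF lin] A.m_assoc)
    qed
    ultimately show ?thesis
      by blast
  qed
  show ?nonneg
    using *[OF assms] by blast
  show "?mult d" if ?eq "a \<in> carrier A" "d \<in> carrier B"
    using *[OF that(3)] that by blast
qed

end

end

section \<open>Bayesian inverses and disintegrations\<close>

locale bayes = cpu A B F
  for A :: "('a, 'm) star_algebra_scheme" and B :: "('b, 'n) star_algebra_scheme" and F +
  fixes \<omega> :: "'a \<Rightarrow> complex"
  assumes state: "state A \<omega>"
begin

definition \<xi> :: "'b \<Rightarrow> complex" where "\<xi> = \<omega> \<circ> F"

lemma \<omega>_pos: "positive_functional A \<omega>" and \<omega>_one [simp]: "\<omega> \<one>\<^bsub>A\<^esub> = 1"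
  using state by (auto simp: state_iff)

lemma \<xi>_pos: "positive_functional B \<xi>" and \<xi>_one [simp]: "\<xi> \<one>\<^bsub>B\<^esub> = 1"
  unfolding \<xi>_def using positive_functional_comp[OF \<omega>_pos] by simp_all

lemma \<xi>_lin: "linear_functional B \<xi>"
  using \<xi>_pos by (simp add: positive_functional_def)

text \<open>The definition multiplies from the left, the Bayes condition from the right; replacing b
  and d by their adjoints and conjugating exchanges the two. The domain D is kept abstract so that
  both A and B can be inserted.\<close>

lemma ae_equiv_iff:
  assumes "linear_map D B H" "linear_map D B K"
    and "\<And>d. d \<in> carrier D \<Longrightarrow> star D d \<in> carrier D \<and> star D (star D d) = d"
    and "\<And>d. d \<in> carrier D \<Longrightarrow> H (star D d) = star B (H d)"
    and "\<And>d. d \<in> carrier D \<Longrightarrow> K (star D d) = star B (K d)"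
  shows "ae_equiv D B \<xi> H K \<longleftrightarrow>
    (\<forall>b\<in>carrier B. \<forall>d\<in>carrier D. \<xi> (H d \<otimes>\<^bsub>B\<^esub> b) = \<xi> (K d \<otimes>\<^bsub>B\<^esub> b))"
proof -
  have eq: "\<xi> (L (star D d) \<otimes>\<^bsub>B\<^esub> star B b) = cnj (\<xi> (b \<otimes>\<^bsub>B\<^esub> L d))"
    if "d \<in> carrier D" "b \<in> carrier B" "linear_map D B L" "L (star D d) = star B (L d)" for L b d
    using B.functional_star[OF \<xi>_pos, of "b \<otimes>\<^bsub>B\<^esub> L d"] that linear_map_closed[OF that(3,1)]
    by (simp add: B.star_mult)
  show ?thesis
  proof
    assume *: "ae_equiv D B \<xi> H K"
    show "\<forall>b\<in>carrier B. \<forall>d\<in>carrier D. \<xi> (H d \<otimes>\<^bsub>B\<^esub> b) = \<xi> (K d \<otimes>\<^bsub>B\<^esub> b)"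
    proof (intro ballI)
      fix b d assume bd: "b \<in> carrier B" "d \<in> carrier D"
      have "\<xi> (star B b \<otimes>\<^bsub>B\<^esub> H (star D d)) = \<xi> (star B b \<otimes>\<^bsub>B\<^esub> K (star D d))"
        using * bd assms(3) by (simp add: ae_equiv_def)
      then show "\<xi> (H d \<otimes>\<^bsub>B\<^esub> b) = \<xi> (K d \<otimes>\<^bsub>B\<^esub> b)"
        using eq[of "star D d" "star B b" H] eq[of "star D d" "star B b" K] bd assms
          linear_map_closed[OF assms(1) bd(2)] linear_map_closed[OF assms(2) bd(2)] by simp
    qed
  next
    assume *: "\<forall>b\<in>carrier B. \<forall>d\<in>carrier D. \<xi> (H d \<otimes>\<^bsub>B\<^esub> b) = \<xi> (K d \<otimes>\<^bsub>B\<^esub> b)"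
    show "ae_equiv D B \<xi> H K"
      unfolding ae_equiv_def
    proof (intro ballI)
      fix b d assume bd: "b \<in> carrier B" "d \<in> carrier D"
      have "\<xi> (H (star D d) \<otimes>\<^bsub>B\<^esub> star B b) = \<xi> (K (star D d) \<otimes>\<^bsub>B\<^esub> star B b)"
        using * bd assms(3) by simp
      then show "\<xi> (b \<otimes>\<^bsub>B\<^esub> H d) = \<xi> (b \<otimes>\<^bsub>B\<^esub> K d)"
        using eq[of d b H] eq[of d b K] bd assms by simp
    qed
  qed
qed

lemma ae_equiv_cpu_iff:
  assumes "cpu_map A B G" "cpu_map A B G'"
  shows "ae_equiv A B \<xi> G G' \<longleftrightarrow>
    (\<forall>b\<in>carrier B. \<forall>a\<in>carrier A. \<xi> (G a \<otimes>\<^bsub>B\<^esub> b) = \<xi> (G' a \<otimes>\<^bsub>B\<^esub> b))"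
proof -
  interpret G: cpu B A G
    by unfold_locales fact
  interpret G': cpu B A G'
    by unfold_locales fact
  show ?thesis
    by (intro ae_equiv_iff G.linear G'.linear) (auto simp: G.star_preserving G'.star_preserving)
qed

lemma ae_equiv_id_iff:
  assumes "cpu_map A B G"
  shows "ae_equiv B B \<xi> (G \<circ> F) id \<longleftrightarrow>
    (\<forall>b\<in>carrier B. \<forall>d\<in>carrier B. \<xi> (G (F d) \<otimes>\<^bsub>B\<^esub> b) = \<xi> (d \<otimes>\<^bsub>B\<^esub> b))"
proof -
  interpret G: cpu B A G
    by unfold_locales fact
  have "linear_map B B id"
    by (simp add: linear_map_def)
  then have "ae_equiv B B \<xi> (G \<circ> F) id \<longleftrightarrow>
    (\<forall>b\<in>carrier B. \<forall>d\<in>carrier B. \<xi> ((G \<circ> F) d \<otimes>\<^bsub>B\<^esub> b) = \<xi> (id d \<otimes>\<^bsub>B\<^esub> b))"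
    by (intro ae_equiv_iff linear_map_comp[OF linear G.linear])
      (auto simp: G.star_preserving star_preserving)
  then show ?thesis
    by simp
qed

lemma bayesian_inverse_unique:
  assumes "cpu_bayesian_inverse B A F \<omega> \<xi> G" "cpu_bayesian_inverse B A F \<omega> \<xi> G'"
  shows "ae_equiv A B \<xi> G G'"
  using assms ae_equiv_cpu_iff[of G G'] by (simp add: cpu_bayesian_inverse_def)

text \<open>Equality in Kadison--Schwarz at all b already yields the three-variable condition, with
  its arbitrary left factor a.\<close>

lemma ae_deterministicI:
  assumes "\<And>b. b \<in> carrier B \<Longrightarrow> \<omega> (F (star B b \<otimes>\<^bsub>B\<^esub> b)) = \<omega> (star A (F b) \<otimes>\<^bsub>A\<^esub> F b)"
  shows "ae_deterministic B A F \<omega>"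
  unfolding ae_deterministic_def using schwarz(2)[OF \<omega>_pos] assms by blast

lemma ae_deterministic_mult:
  assumes "ae_deterministic B A F \<omega>" "b \<in> carrier B" "d \<in> carrier B"
  shows "\<omega> (F b \<otimes>\<^bsub>A\<^esub> F d) = \<omega> (F (b \<otimes>\<^bsub>B\<^esub> d))"
  using bspec[OF assms(1)[unfolded ae_deterministic_def], of "\<one>\<^bsub>A\<^esub>"] assms(2,3) by simp

lemma ae_deterministic_iff_disintegration:
  assumes G: "cpu_bayesian_inverse B A F \<omega> \<xi> G"
  shows "ae_deterministic B A F \<omega> \<longleftrightarrow> cpu_disintegration B A F \<omega> \<xi> G"
proof -
  have cpu: "cpu_map A B G"
    and bayes: "\<And>a b. a \<in> carrier A \<Longrightarrow> b \<in> carrier B \<Longrightarrow> \<xi> (G a \<otimes>\<^bsub>B\<^esub> b) = \<omega> (a \<otimes>\<^bsub>A\<^esub> F b)"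
    using G by (auto simp: cpu_bayesian_inverse_def)
  interpret G: cpu B A G
    by unfold_locales fact
  have marginal: "\<xi> (G a) = \<omega> a" if "a \<in> carrier A" for a
    using bayes[OF that B.one_closed] that by simp
  have "cpu_disintegration B A F \<omega> \<xi> G \<longleftrightarrow> ae_equiv B B \<xi> (G \<circ> F) id"
    using cpu marginal by (simp add: cpu_disintegration_def)
  also have "\<dots> \<longleftrightarrow> (\<forall>b\<in>carrier B. \<forall>d\<in>carrier B. \<omega> (F d \<otimes>\<^bsub>A\<^esub> F b) = \<omega> (F (d \<otimes>\<^bsub>B\<^esub> b)))"
    unfolding ae_equiv_id_iff[OF cpu] using bayes by (simp add: \<xi>_def)
  also have "\<dots> \<longleftrightarrow> ae_deterministic B A F \<omega>"
  proof
    assume *: "\<forall>b\<in>carrier B. \<forall>d\<in>carrier B. \<omega> (F d \<otimes>\<^bsub>A\<^esub> F b) = \<omega> (F (d \<otimes>\<^bsub>B\<^esub> b))"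
    show "ae_deterministic B A F \<omega>"
      \<comment> \<open>The disintegration property speaks only about the left factor 1. Taking d =
        star b turns it into equality in Kadison--Schwarz, which recovers every left factor.\<close>
      by (rule ae_deterministicI) (metis * B.star_closed star_preserving)
  qed (auto simp: ae_deterministic_mult)
  finally show ?thesis ..
qed

text \<open>Kadison--Schwarz for \<open>F\<close> and \<open>G\<close> gives \<open>\<xi>(b\<^sup>* b) \<ge> \<omega> (F(b)\<^sup>* F(b)) \<ge> \<xi>(G(F(b))\<^sup>* G(F(b)))\<close>.
  The outer terms agree, so both inequalities are equalities.\<close>

lemma disintegration_imp:
  assumes "cpu_disintegration B A F \<omega> \<xi> G"
  shows "ae_deterministic B A F \<omega>" and "cpu_bayesian_inverse B A F \<omega> \<xi> G"
proof -
  have cpu: "cpu_map A B G" and marginal: "\<And>a. a \<in> carrier A \<Longrightarrow> \<xi> (G a) = \<omega> a"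
    and ae: "ae_equiv B B \<xi> (G \<circ> F) id"
    using assms by (auto simp: cpu_disintegration_def)
  interpret G: cpu B A G
    by unfold_locales fact
  have left: "\<xi> (b \<otimes>\<^bsub>B\<^esub> G (F d)) = \<xi> (b \<otimes>\<^bsub>B\<^esub> d)"
    and right: "\<xi> (G (F d) \<otimes>\<^bsub>B\<^esub> b) = \<xi> (d \<otimes>\<^bsub>B\<^esub> b)"
    if "b \<in> carrier B" "d \<in> carrier B" for b d
    using ae ae_equiv_id_iff[OF cpu] that by (auto simp: ae_equiv_def)
  have squares: "\<omega> (F (star B b \<otimes>\<^bsub>B\<^esub> b)) = \<omega> (star A (F b) \<otimes>\<^bsub>A\<^esub> F b) \<and>
      \<xi> (G (star A (F b) \<otimes>\<^bsub>A\<^esub> F b)) = \<xi> (star B (G (F b)) \<otimes>\<^bsub>B\<^esub> G (F b))"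
    if b: "b \<in> carrier B" for b
  proof -
    have "\<xi> (star B (G (F b)) \<otimes>\<^bsub>B\<^esub> G (F b)) = \<xi> (G (F (star B b)) \<otimes>\<^bsub>B\<^esub> b)"
      using b left[of "star B (G (F b))" b] by (simp add: star_preserving G.star_preserving)
    also have "\<dots> = \<xi> (star B b \<otimes>\<^bsub>B\<^esub> b)"
      using b right by simp
    finally have "\<xi> (star B (G (F b)) \<otimes>\<^bsub>B\<^esub> G (F b)) = \<omega> (F (star B b \<otimes>\<^bsub>B\<^esub> b))"
      by (simp add: \<xi>_def)
    moreover have "\<xi> (G (star A (F b) \<otimes>\<^bsub>A\<^esub> F b)) = \<omega> (star A (F b) \<otimes>\<^bsub>A\<^esub> F b)"
      using b by (simp add: marginal)
    ultimately show ?thesis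
      \<comment> \<open>The two nonnegative Schwarz defects add up to zero, so both vanish.\<close>
      using schwarz(1)[OF \<omega>_pos b] G.schwarz(1)[OF \<xi>_pos closed[OF b]]
      by (auto simp: complex_nonneg_Reals_iff complex_eq_iff)
  qed
  then show "ae_deterministic B A F \<omega>"
    by (intro ae_deterministicI) blast
  have "\<xi> (G a \<otimes>\<^bsub>B\<^esub> b) = \<omega> (a \<otimes>\<^bsub>A\<^esub> F b)" if a: "a \<in> carrier A" and b: "b \<in> carrier B" for a b
  proof -
    \<comment> \<open>First b is replaced by G(F(b)) under \<xi>, then G is multiplicative at F(b)
      by the second equality of \<open>squares\<close>. The factor 1 only matches the shape of
      \<open>schwarz\<close>.\<close>
    have "\<xi> (G a \<otimes>\<^bsub>B\<^esub> b) = \<xi> (\<one>\<^bsub>B\<^esub> \<otimes>\<^bsub>B\<^esub> G a \<otimes>\<^bsub>B\<^esub> G (F b))"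
      using a b left[of "G a" b] by simp
    also have "\<dots> = \<xi> (\<one>\<^bsub>B\<^esub> \<otimes>\<^bsub>B\<^esub> G (a \<otimes>\<^bsub>A\<^esub> F b))"
      using squares[OF b] a b by (intro G.schwarz(2)[OF \<xi>_pos]) auto
    also have "\<dots> = \<omega> (a \<otimes>\<^bsub>A\<^esub> F b)"
      using a b by (simp add: marginal)
    finally show ?thesis .
  qed
  then show "cpu_bayesian_inverse B A F \<omega> \<xi> G"
    using cpu by (simp add: cpu_bayesian_inverse_def)
qed

end

section \<open>Maps into a diagonal subalgebra\<close>

lemma linear_map_amplify:
  assumes "linear_map A B F"
  shows "linear_map (mat_algebra n A) (mat_algebra n B) (amplify n F)"
  using assms unfolding linear_map_def amplify_def mat_algebra_def Let_def
  by (auto intro!: restrict_ext) (auto simp: PiE_def Pi_def)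

section \<open>Positive semidefinite complex matrices and their Cholesky factorization\<close>

lemma sum_nonneg_Reals:
  fixes f :: "'i \<Rightarrow> complex"
  shows "(\<And>i. i \<in> I \<Longrightarrow> f i \<in> \<real>\<^sub>\<ge>\<^sub>0) \<Longrightarrow> sum f I \<in> \<real>\<^sub>\<ge>\<^sub>0"
  by (induction I rule: infinite_finite_induct) auto

text \<open>Hermitian symmetry is implied: a complex quadratic form with only real values comes from
  a hermitian matrix.\<close>

definition psd_matrix :: "nat \<Rightarrow> (nat \<Rightarrow> nat \<Rightarrow> complex) \<Rightarrow> bool" where
  "psd_matrix n M \<longleftrightarrow> (\<forall>c. (\<Sum>i<n. \<Sum>j<n. cnj (c i) * M i j * c j) \<in> \<real>\<^sub>\<ge>\<^sub>0)"

lemma psd_matrix_Suc: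
  assumes "psd_matrix (Suc n) M"
  shows "(\<Sum>i<n. \<Sum>j<n. cnj (c i) * M i j * c j) + t * (\<Sum>i<n. cnj (c i) * M i n)
    + cnj t * (\<Sum>j<n. M n j * c j) + t * cnj t * M n n \<in> \<real>\<^sub>\<ge>\<^sub>0"
proof -
  let ?c = "\<lambda>i. if i = n then t else c i"
  have "(\<Sum>i<Suc n. \<Sum>j<Suc n. cnj (?c i) * M i j * ?c j) \<in> \<real>\<^sub>\<ge>\<^sub>0"
    using assms unfolding psd_matrix_def by (rule spec)
  also have "(\<Sum>i<Suc n. \<Sum>j<Suc n. cnj (?c i) * M i j * ?c j) =
      (\<Sum>i<n. \<Sum>j<n. cnj (c i) * M i j * c j) + t * (\<Sum>i<n. cnj (c i) * M i n)
      + cnj t * (\<Sum>j<n. M n j * c j) + t * cnj t * M n n"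
    by (simp add: sum.distrib sum_distrib_left algebra_simps)
  finally show ?thesis .
qed

text \<open>Everything is read off from the form on vectors e_i + t e_n, that is, from 2 by 2
  principal submatrices.\<close>

lemma psd_matrix_last:
  assumes "psd_matrix (Suc n) M"
  shows "M n n \<in> \<real>\<^sub>\<ge>\<^sub>0" and "i < n \<Longrightarrow> M i n = cnj (M n i)"
    and "M n n = 0 \<Longrightarrow> i < n \<Longrightarrow> M n i = 0" and "psd_matrix n M"
proof -
  show "M n n \<in> \<real>\<^sub>\<ge>\<^sub>0"
    using psd_matrix_Suc[OF assms, of "\<lambda>_. 0" 1] by simp
  show psd: "psd_matrix n M"
    unfolding psd_matrix_def using psd_matrix_Suc[OF assms, of _ 0] by simp
  have expand: "M i i + t * M i n + cnj t * M n i + t * cnj t * M n n \<in> \<real>\<^sub>\<ge>\<^sub>0" if "i < n" for i t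
  proof -
    define e :: "nat \<Rightarrow> complex" where "e j = of_bool (j = i)" for j
    have cnj_e: "cnj (e j) = e j" for j
      by (simp add: e_def)
    have sum_e: "(\<Sum>j<n. e j * f j) = f i" for f
    proof -
      have "(\<Sum>j<n. e j * f j) = (\<Sum>j<n. if j = i then f j else 0)"
        by (intro sum.cong) (auto simp: e_def)
      then show ?thesis
        using that by simp
    qed
    have "(\<Sum>k<n. \<Sum>j<n. e k * M k j * e j) = (\<Sum>k<n. e k * (\<Sum>j<n. e j * M k j))"
      unfolding sum_distrib_left by (intro sum.cong refl) (simp only: mult_ac)
    moreover have "(\<Sum>j<n. M n j * e j) = (\<Sum>j<n. e j * M n j)"
      by (intro sum.cong refl) (simp only: mult_ac)
    ultimately show ?thesis
      using psd_matrix_Suc[OF assms, of e t] by (simp only: cnj_e sum_e)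
  qed
  have diag: "M i i \<in> \<real>\<^sub>\<ge>\<^sub>0" if "i < n" for i
    using expand[OF that, of 0] by simp
  show herm: "M i n = cnj (M n i)" if "i < n" for i
    using expand[OF that, of 1] expand[OF that, of \<i>] diag[OF that] \<open>M n n \<in> \<real>\<^sub>\<ge>\<^sub>0\<close>
    by (auto simp: complex_nonneg_Reals_iff complex_eq_iff)
  show "M n i = 0" if "M n n = 0" "i < n"
  proof (rule nonneg_quadratic_imp_zero)
    fix t
    show "Re (M i i + t * M n i + cnj (t * M n i)) \<ge> 0"
      using expand[OF that(2), of "cnj t"] that herm[OF that(2)]
      by (simp add: complex_nonneg_Reals_iff)
  qed
qed

text \<open>Completing the square: the form of the Schur complement at c is the full form at c
  extended by the last coordinate t = - s / M_nn.\<close>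

lemma psd_matrix_schur_complement:
  assumes "psd_matrix (Suc n) M" "M n n \<noteq> 0"
  shows "psd_matrix n (\<lambda>i j. M i j - M i n * M n j / M n n)"
  unfolding psd_matrix_def
proof
  fix c
  define s where "s = (\<Sum>j<n. M n j * c j)"
  have s: "(\<Sum>i<n. cnj (c i) * M i n) = cnj s"
    using psd_matrix_last(2)[OF assms(1)] by (simp add: s_def mult.commute)
  have real: "cnj (M n n) = M n n"
    using psd_matrix_last(1)[OF assms(1)] by (auto simp: complex_nonneg_Reals_iff complex_eq_iff)
  have "(\<Sum>i<n. \<Sum>j<n. cnj (c i) * (M i n * M n j / M n n) * c j) =
      (\<Sum>i<n. \<Sum>j<n. (cnj (c i) * M i n) * (M n j * c j)) / M n n"
    by (simp add: sum_divide_distrib mult_ac)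
  also have "\<dots> = cnj s * s / M n n"
    unfolding sum_product[symmetric] s by (simp add: s_def)
  finally have "(\<Sum>i<n. \<Sum>j<n. cnj (c i) * (M i j - M i n * M n j / M n n) * c j) =
      (\<Sum>i<n. \<Sum>j<n. cnj (c i) * M i j * c j) - cnj s * s / M n n"
    by (simp add: right_diff_distrib left_diff_distrib sum_subtractf)
  also have "\<dots> = (\<Sum>i<n. \<Sum>j<n. cnj (c i) * M i j * c j) + (- s / M n n) * (\<Sum>i<n. cnj (c i) * M i n)
      + cnj (- s / M n n) * (\<Sum>j<n. M n j * c j) + (- s / M n n) * cnj (- s / M n n) * M n n"
    using assms(2) unfolding s s_def[symmetric] by (simp add: real field_simps)
  also have "\<dots> \<in> \<real>\<^sub>\<ge>\<^sub>0"
    by (rule psd_matrix_Suc[OF assms(1)])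
  finally show "(\<Sum>i<n. \<Sum>j<n. cnj (c i) * (M i j - M i n * M n j / M n n) * c j) \<in> \<real>\<^sub>\<ge>\<^sub>0" .
qed

text \<open>Elimination from the last index: the last row of M, divided by the square root of its
  diagonal entry, gives row n of W; the Schur complement supplies the other rows by induction. A
  zero diagonal entry forces a zero row, which fits the convention x / 0 = 0.\<close>

lemma cholesky:
  assumes "psd_matrix n M"
  shows "\<exists>W. \<forall>i<n. \<forall>j<n. M i j = (\<Sum>k<n. cnj (W k i) * W k j)"
  using assms
proof (induction n arbitrary: M)
  case (Suc n)
  note last = psd_matrix_last[OF Suc.prems]
  define m where "m = Re (M n n)"
  have m: "M n n = of_real m" "m \<ge> 0"
    using last(1) by (auto simp: m_def complex_nonneg_Reals_iff complex_eq_iff)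
  define r where "r j = M n j / of_real (sqrt m)" for j
  have r: "cnj (r i) * r j = M i n * M n j / M n n" if "i < n" for i j
  proof -
    have "cnj (M n i) = M i n"
      using last(2)[OF that] by simp
    moreover have "complex_of_real (sqrt m) * complex_of_real (sqrt m) = of_real m"
      using m by (metis of_real_mult real_sqrt_mult_self abs_of_nonneg)
    ultimately show ?thesis
      by (simp add: r_def m(1))
  qed
  have "psd_matrix n (\<lambda>i j. M i j - M i n * M n j / M n n)"
    \<comment> \<open>If M_nn = 0, the subtracted quotient is 0 by convention and the claim is that
      the leading block of M is positive semidefinite.\<close>
    using last(4) psd_matrix_schur_complement[OF Suc.prems] by (cases "M n n = 0") auto
  from Suc.IH[OF this] obtain V where "\<forall>i<n. \<forall>j<n.
      M i j - M i n * M n j / M n n = (\<Sum>k<n. cnj (V k i) * V k j)"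
    by blast
  note V = this[rule_format]
  define W where "W k j = (if k = n then r j else if j = n then 0 else V k j)" for k j
  have W: "(\<Sum>k<Suc n. cnj (W k i) * W k j) =
      (if i = n \<or> j = n then 0 else (\<Sum>k<n. cnj (V k i) * V k j)) + cnj (r i) * r j" for i j
    by (auto simp: W_def)
  have "M i j = (\<Sum>k<Suc n. cnj (W k i) * W k j)" if "i < Suc n" "j < Suc n" for i j
  proof (cases "i < n")
    case True
    \<comment> \<open>True also for M_nn = 0, since then M i n is the conjugate of M n i =
      0.\<close>
    have "M i n * M n n / M n n = M i n"
      using last(2,3)[of i] True by auto
    then show ?thesis
      using True that V[of i j] unfolding W by (auto simp: r[OF True] less_Suc_eq diff_eq_eq)
  next
    case False
    then have "i = n"
      using that by simp
    have "r n = of_real (m / sqrt m)"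
      by (simp add: r_def m(1))
    then have rn: "cnj (r n) = of_real (sqrt m)"
      using m(2) by (simp add: real_div_sqrt del: of_real_divide)
    have "M n j = of_real (sqrt m) * r j"
    proof (cases "m = 0")
      case True
      then show ?thesis
        using last(3)[of j] that m(1) by (cases "j = n") (auto simp: r_def)
    qed (simp add: r_def)
    then show ?thesis
      using \<open>i = n\<close> rn unfolding W by simp
  qed
  then show ?case
    by blast
qed simp

section \<open>Orthogonal resolutions of the unit and completely positive maps into their
  span\<close>

locale orthogonal_resolution = star_algebra B for B (structure) +
  fixes J :: "'i set" and q
  assumes finite_index: "finite J"
    and q_closed: "j \<in> J \<Longrightarrow> q j \<in> carrier B"
    and q_star: "j \<in> J \<Longrightarrow> star B (q j) = q j"
    and q_idem: "j \<in> J \<Longrightarrow> q j \<otimes> q j = q j"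
    and q_orth: "i \<in> J \<Longrightarrow> j \<in> J \<Longrightarrow> i \<noteq> j \<Longrightarrow> q i \<otimes> q j = \<zero>"
    and q_sum: "(\<Oplus>j\<in>J. q j) = \<one>"
begin

text \<open>The unital star-homomorphism from the functions on J, with pointwise operations, into
  B.\<close>

definition diagonal where "diagonal c = (\<Oplus>j\<in>J. c j \<odot> q j)"

lemma diagonal_closed [simp, intro]: "diagonal c \<in> carrier B"
  unfolding diagonal_def using q_closed by (intro finsum_closed) auto

lemma diagonal_one: "(\<And>j. j \<in> J \<Longrightarrow> c j = 1) \<Longrightarrow> diagonal c = \<one>"
  unfolding diagonal_def q_sum[symmetric] using q_closed by (intro finsum_cong') auto

lemma diagonal_add: "diagonal (\<lambda>j. c j + d j) = diagonal c \<oplus> diagonal d"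
proof -
  have "diagonal (\<lambda>j. c j + d j) = (\<Oplus>j\<in>J. c j \<odot> q j \<oplus> d j \<odot> q j)"
    unfolding diagonal_def using q_closed by (intro finsum_cong') (auto simp: smult_add_left)
  also have "\<dots> = diagonal c \<oplus> diagonal d"
    unfolding diagonal_def using q_closed by (intro finsum_addf) auto
  finally show ?thesis .
qed

lemma diagonal_smult: "diagonal (\<lambda>j. t * c j) = t \<odot> diagonal c"
  unfolding diagonal_def using q_closed finite_index
  by (subst smult_finsum) (auto intro!: finsum_cong' simp: smult_smult)

lemma diagonal_star: "star B (diagonal c) = diagonal (\<lambda>j. cnj (c j))"
  unfolding diagonal_def using q_closed finite_index
  by (subst star_finsum) (auto intro!: finsum_cong' simp: star_smult q_star)

lemma diagonal_mult_q: "i \<in> J \<Longrightarrow> diagonal c \<otimes> q i = c i \<odot> q i"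
proof -
  assume i: "i \<in> J"
  have "diagonal c \<otimes> q i = (\<Oplus>j\<in>J. (c j \<odot> q j) \<otimes> q i)"
    unfolding diagonal_def using q_closed finite_index i by (intro finsum_ldistr) auto
  also have "\<dots> = (\<Oplus>j\<in>J. if i = j then (\<lambda>j. c j \<odot> q j) j else \<zero>)"
    using q_closed q_idem q_orth i by (intro finsum_cong') (auto simp: smult_mult_left)
  also have "\<dots> = c i \<odot> q i"
    using q_closed finite_index i by (intro finsum_singleton) auto
  finally show ?thesis .
qed

lemma diagonal_mult: "diagonal c \<otimes> diagonal d = diagonal (\<lambda>j. c j * d j)"
proof -
  have "diagonal c \<otimes> diagonal d = (\<Oplus>j\<in>J. diagonal c \<otimes> (d j \<odot> q j))"
    unfolding diagonal_def[of d] using q_closed finite_index by (intro finsum_rdistr) auto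
  also have "\<dots> = diagonal (\<lambda>j. c j * d j)"
    unfolding diagonal_def[of "\<lambda>j. c j * d j"] using q_closed
    by (intro finsum_cong') (auto simp: smult_mult_right diagonal_mult_q smult_smult mult.commute)
  finally show ?thesis .
qed

lemma diagonal_finsum:
  assumes "finite K"
  shows "(\<Oplus>k\<in>K. diagonal (c k)) = diagonal (\<lambda>j. \<Sum>k\<in>K. c k j)"
  using assms
proof (induction K rule: finite_induct)
  case empty
  show ?case
    using diagonal_smult[of 0 "\<lambda>_. 0"] by simp
next
  case (insert k K)
  then show ?case
    by (simp add: diagonal_add)
qed

lemma diagonal_cong: "(\<And>j. j \<in> J \<Longrightarrow> c j = d j) \<Longrightarrow> diagonal c = diagonal d"
  unfolding diagonal_def using q_closed by (intro finsum_cong') auto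

text \<open>The reason that positive maps into commutative algebras are completely positive: for
  each l in J, \<phi> l sends the Gram matrix to a positive semidefinite scalar matrix, and the
  Cholesky factors W l are the coordinates of one factor z over B.\<close>

lemma cpu_map_diagonal:
  assumes A: "star_algebra A" and \<phi>: "\<And>j. j \<in> J \<Longrightarrow> state A (\<phi> j)"
  shows "cpu_map A B (\<lambda>a. diagonal (\<lambda>j. \<phi> j a))" (is "cpu_map A B ?G")
proof -
  interpret A: star_algebra A by fact
  have pos: "positive_functional A (\<phi> j)" and one: "\<phi> j \<one>\<^bsub>A\<^esub> = 1" if "j \<in> J" for j
    using \<phi>[OF that] by (auto simp: state_iff)
  have lin: "linear_functional A (\<phi> j)" if "j \<in> J" for j
    using pos[OF that] by (simp add: positive_functional_def)
  have G: "linear_map A B ?G"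
    unfolding linear_map_def diagonal_add[symmetric] diagonal_smult[symmetric]
    by (auto intro!: diagonal_cong simp: A.functional_add[OF lin] A.functional_smult[OF lin])
  have "positive_map (mat_algebra n A) (mat_algebra n B) (amplify n ?G)" for n
    unfolding positive_map_def
  proof (intro conjI allI impI)
    show "linear_map (mat_algebra n A) (mat_algebra n B) (amplify n ?G)"
      using G by (rule linear_map_amplify)
  next
    fix x assume "positive (mat_algebra n A) x"
    let ?I = "{..<n} \<times> {..<n}"
    obtain y where y: "y \<in> ?I \<rightarrow>\<^sub>E carrier A"
      and x: "x = (\<lambda>(i, j)\<in>?I. \<Oplus>\<^bsub>A\<^esub>k\<in>{..<n}. star A (y (k, i)) \<otimes>\<^bsub>A\<^esub> y (k, j))"
      using \<open>positive (mat_algebra n A) x\<close> by (auto simp: A.positive_mat_algebra_iff)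
    have y: "y (k, i) \<in> carrier A" if "k < n" "i < n" for k i
      using PiE_mem[OF y] that by auto
    define M where "M l i j = (\<Sum>k<n. \<phi> l (star A (y (k, i)) \<otimes>\<^bsub>A\<^esub> y (k, j)))" for l i j
    have "psd_matrix n (M l)" if l: "l \<in> J" for l
      unfolding psd_matrix_def
    proof
      fix c
      \<comment> \<open>v is y applied to the vector c, so the quadratic form of M l at c is the sum
        of the nonnegative \<phi> l (v_k^* v_k).\<close>
      define v where "v k = (\<Oplus>\<^bsub>A\<^esub>i\<in>{..<n}. c i \<odot>\<^bsub>A\<^esub> y (k, i))" for k
      have v: "v k \<in> carrier A" if "k < n" for k
        unfolding v_def using y that by (intro A.finsum_closed) auto
      have "star A (v k) \<otimes>\<^bsub>A\<^esub> v k =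
          (\<Oplus>\<^bsub>A\<^esub>i\<in>{..<n}. \<Oplus>\<^bsub>A\<^esub>j\<in>{..<n}. (cnj (c i) * c j) \<odot>\<^bsub>A\<^esub> (star A (y (k, i)) \<otimes>\<^bsub>A\<^esub> y (k, j)))"
        if k: "k < n" for k
      proof -
        have "star A (v k) \<otimes>\<^bsub>A\<^esub> v k =
            (\<Oplus>\<^bsub>A\<^esub>i\<in>{..<n}. cnj (c i) \<odot>\<^bsub>A\<^esub> star A (y (k, i))) \<otimes>\<^bsub>A\<^esub> v k"
          unfolding v_def using y k
          by (subst A.star_finsum) (auto intro!: arg_cong2[where f = "mult A"] A.finsum_cong' simp: A.star_smult)
        also have "\<dots> = (\<Oplus>\<^bsub>A\<^esub>i\<in>{..<n}. (cnj (c i) \<odot>\<^bsub>A\<^esub> star A (y (k, i))) \<otimes>\<^bsub>A\<^esub> v k)"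
          using v y k by (intro A.finsum_ldistr) auto
        also have "\<dots> = (\<Oplus>\<^bsub>A\<^esub>i\<in>{..<n}. \<Oplus>\<^bsub>A\<^esub>j\<in>{..<n}.
            (cnj (c i) \<odot>\<^bsub>A\<^esub> star A (y (k, i))) \<otimes>\<^bsub>A\<^esub> (c j \<odot>\<^bsub>A\<^esub> y (k, j)))"
          unfolding v_def using y k
          by (intro A.finsum_cong' A.finsum_rdistr) (auto intro!: A.finsum_closed)
        also have "\<dots> = (\<Oplus>\<^bsub>A\<^esub>i\<in>{..<n}. \<Oplus>\<^bsub>A\<^esub>j\<in>{..<n}.
            (cnj (c i) * c j) \<odot>\<^bsub>A\<^esub> (star A (y (k, i)) \<otimes>\<^bsub>A\<^esub> y (k, j)))"
          using y k
          by (intro A.finsum_cong')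
            (auto intro!: A.finsum_closed simp: A.smult_mult_left A.smult_mult_right A.smult_smult mult.commute)
        finally show ?thesis .
      qed
      then have "\<phi> l (star A (v k) \<otimes>\<^bsub>A\<^esub> v k) =
          (\<Sum>i<n. \<Sum>j<n. cnj (c i) * c j * \<phi> l (star A (y (k, i)) \<otimes>\<^bsub>A\<^esub> y (k, j)))" if "k < n" for k
        using y that
        by (simp add: A.functional_finsum[OF lin[OF l]] A.functional_smult[OF lin[OF l]] Pi_def)
      then have "(\<Sum>k<n. \<phi> l (star A (v k) \<otimes>\<^bsub>A\<^esub> v k)) =
          (\<Sum>k<n. \<Sum>i<n. \<Sum>j<n. cnj (c i) * c j * \<phi> l (star A (y (k, i)) \<otimes>\<^bsub>A\<^esub> y (k, j)))"
        by simp
      also have "\<dots> = (\<Sum>i<n. \<Sum>k<n. \<Sum>j<n. cnj (c i) * c j * \<phi> l (star A (y (k, i)) \<otimes>\<^bsub>A\<^esub> y (k, j)))"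
        by (rule sum.swap)
      also have "\<dots> = (\<Sum>i<n. \<Sum>j<n. \<Sum>k<n. cnj (c i) * c j * \<phi> l (star A (y (k, i)) \<otimes>\<^bsub>A\<^esub> y (k, j)))"
        by (intro sum.cong refl sum.swap)
      also have "\<dots> = (\<Sum>i<n. \<Sum>j<n. cnj (c i) * M l i j * c j)"
        by (simp add: M_def sum_distrib_left sum_distrib_right mult_ac)
      finally have "(\<Sum>i<n. \<Sum>j<n. cnj (c i) * M l i j * c j) = (\<Sum>k<n. \<phi> l (star A (v k) \<otimes>\<^bsub>A\<^esub> v k))" ..
      also have "\<dots> \<in> \<real>\<^sub>\<ge>\<^sub>0"
        using pos[OF l] v by (intro sum_nonneg_Reals) (auto simp: positive_functional_def)
      finally show "(\<Sum>i<n. \<Sum>j<n. cnj (c i) * M l i j * c j) \<in> \<real>\<^sub>\<ge>\<^sub>0" .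
    qed
    then have "\<forall>l\<in>J. \<exists>W. \<forall>i<n. \<forall>j<n. M l i j = (\<Sum>k<n. cnj (W k i) * W k j)"
      using cholesky by blast
    then obtain W where W: "\<And>l i j. l \<in> J \<Longrightarrow> i < n \<Longrightarrow> j < n \<Longrightarrow>
        M l i j = (\<Sum>k<n. cnj (W l k i) * W l k j)"
      by metis
    define z where "z = (\<lambda>(k, i)\<in>?I. diagonal (\<lambda>l. W l k i))"
    have "amplify n ?G x = (\<lambda>(i, j)\<in>?I. \<Oplus>k\<in>{..<n}. star B (z (k, i)) \<otimes> z (k, j))"
      unfolding amplify_def
    proof (intro restrict_ext, clarify)
      fix i j assume ij: "i < n" "j < n"
      have "\<phi> l (x (i, j)) = (\<Sum>k<n. cnj (W l k i) * W l k j)" if "l \<in> J" for l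
      proof -
        have "\<phi> l (x (i, j)) = M l i j"
          using y ij that by (simp add: x M_def A.functional_finsum[OF lin] Pi_def)
        then show ?thesis
          using W that ij by simp
      qed
      then have "?G (x (i, j)) = diagonal (\<lambda>l. \<Sum>k<n. cnj (W l k i) * W l k j)"
        by (intro diagonal_cong)
      also have "\<dots> = (\<Oplus>k\<in>{..<n}. diagonal (\<lambda>l. cnj (W l k i) * W l k j))"
        by (simp add: diagonal_finsum)
      also have "\<dots> = (\<Oplus>k\<in>{..<n}. star B (z (k, i)) \<otimes> z (k, j))"
        using ij by (intro finsum_cong') (auto simp: z_def diagonal_star diagonal_mult)
      finally show "?G (x (i, j)) = (\<Oplus>k\<in>{..<n}. star B (z (k, i)) \<otimes> z (k, j))" .
    qed
    moreover have "z \<in> ?I \<rightarrow>\<^sub>E carrier B"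
      by (auto simp: z_def)
    ultimately show "positive (mat_algebra n B) (amplify n ?G x)"
      unfolding positive_mat_algebra_iff by blast
  qed
  then show ?thesis
    using G one by (simp add: cpu_map_def diagonal_one)
qed

end

section \<open>Minimal projections in finite-dimensional C*-algebras\<close>

text \<open>S indexes the equations and J the unknowns. Gaussian elimination: each induction step
  removes one equation and one unknown.\<close>

lemma homogeneous_system:
  fixes c :: "'j \<Rightarrow> 's \<Rightarrow> complex"
  assumes "finite S" "finite J" "card S < card J"
  shows "\<exists>\<alpha>. (\<exists>j\<in>J. \<alpha> j \<noteq> 0) \<and> (\<forall>s\<in>S. (\<Sum>j\<in>J. \<alpha> j * c j s) = 0)"
  using assms
proof (induction S arbitrary: J c rule: finite_induct)
  case empty
  then have "J \<noteq> {}"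
    by auto
  then show ?case
    by (auto intro!: exI[of _ "\<lambda>_. 1"])
next
  case (insert s S)
  show ?case
  proof (cases "\<forall>j\<in>J. c j s = 0")
    case True
    have "card S < card J"
      using insert by simp
    from insert.IH[OF insert.prems(1) this] True show ?thesis
      by fastforce
  next
    case False
    then obtain i where i: "i \<in> J" "c i s \<noteq> 0"
      by blast
    \<comment> \<open>Unknown i is the pivot for equation s. Eliminating it leaves the coefficients
      d in the other equations; \<alpha> i below is the pivot value solved back from equation
      s.\<close>
    define d where "d j t = c j t - c j s / c i s * c i t" for j t
    have "card S < card (J - {i})"
      using insert.prems insert.hyps i by simp
    from insert.IH[OF _ this, of d] insert.prems(1)
    obtain \<beta> k where \<beta>: "k \<in> J - {i}" "\<beta> k \<noteq> 0" "\<forall>t\<in>S. (\<Sum>j\<in>J - {i}. \<beta> j * d j t) = 0"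
      by auto
    define \<alpha> where "\<alpha> = \<beta>(i := - (\<Sum>j\<in>J - {i}. \<beta> j * c j s) / c i s)"
    have "(\<Sum>j\<in>J. \<alpha> j * c j t) = (\<Sum>j\<in>J - {i}. \<beta> j * d j t)" for t
    proof -
      have "(\<Sum>j\<in>J. \<alpha> j * c j t) = \<alpha> i * c i t + (\<Sum>j\<in>J - {i}. \<beta> j * c j t)"
        using insert.prems(1) i by (subst sum.remove[of _ i]) (auto simp: \<alpha>_def)
      also have "\<alpha> i * c i t = - (\<Sum>j\<in>J - {i}. \<beta> j * (c j s / c i s * c i t))"
        by (simp add: \<alpha>_def sum_divide_distrib sum_distrib_right sum_negf mult.assoc)
      finally show ?thesis
        by (simp add: d_def right_diff_distrib sum_subtractf)
    qed
    moreover have "d j s = 0" for j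
      using i by (simp add: d_def)
    ultimately have "\<forall>t\<in>insert s S. (\<Sum>j\<in>J. \<alpha> j * c j t) = 0"
      using \<beta>(3) by simp
    moreover have "k \<in> J" "\<alpha> k \<noteq> 0"
      using \<beta> by (auto simp: \<alpha>_def)
    ultimately show ?thesis
      by blast
  qed
qed

context star_algebra
begin

lemma smult_eq_zero_iff: "x \<in> carrier A \<Longrightarrow> c \<odot> x = \<zero> \<longleftrightarrow> c = 0 \<or> x = \<zero>"
  by (metis field_class.field_inverse one_smult smult_smult smult_zero zero_smult)

lemma smult_cancel_right:
  assumes "x \<in> carrier A" "x \<noteq> \<zero>" "c \<odot> x = d \<odot> x"
  shows "c = d"
proof -
  have "(c + - d) \<odot> x = \<zero>"
    using assms by (simp only: smult_add_left minus_smult) (simp add: r_neg)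
  then show ?thesis
    using assms by (simp add: smult_eq_zero_iff)
qed

definition projection where
  "projection p \<longleftrightarrow> p \<in> carrier A \<and> star A p = p \<and> p \<otimes> p = p"

lemma linear_dependence:
  assumes S: "finite S" "S \<subseteq> carrier A" "\<forall>x\<in>carrier A. \<exists>c. x = (\<Oplus>s\<in>S. c s \<odot> s)"
    and J: "finite J" "card S < card J" "v \<in> J \<rightarrow> carrier A"
  shows "\<exists>\<alpha>. (\<exists>j\<in>J. \<alpha> j \<noteq> 0) \<and> (\<Oplus>j\<in>J. \<alpha> j \<odot> v j) = \<zero>"
proof -
  have "\<forall>j\<in>J. \<exists>c. v j = (\<Oplus>s\<in>S. c s \<odot> s)"
    using S(3) J(3) by blast
  then obtain c where c: "\<And>j. j \<in> J \<Longrightarrow> v j = (\<Oplus>s\<in>S. c j s \<odot> s)"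
    by metis
  obtain \<alpha> where \<alpha>: "\<exists>j\<in>J. \<alpha> j \<noteq> 0" "\<forall>s\<in>S. (\<Sum>j\<in>J. \<alpha> j * c j s) = 0"
    using homogeneous_system[OF S(1) J(1,2), of c] by blast
  have sum_smult: "(\<Oplus>j\<in>K. f j \<odot> s) = (\<Sum>j\<in>K. f j) \<odot> s" if "finite K" "s \<in> carrier A"
    for K s and f :: "'c \<Rightarrow> complex"
    using that by (induction K rule: finite_induct) (auto simp: smult_add_left)
  have "(\<Oplus>j\<in>J. \<alpha> j \<odot> v j) = (\<Oplus>j\<in>J. \<Oplus>s\<in>S. (\<alpha> j * c j s) \<odot> s)"
  proof (intro finsum_cong')
    fix j assume "j \<in> J"
    have "\<alpha> j \<odot> v j = (\<Oplus>s\<in>S. \<alpha> j \<odot> (c j s \<odot> s))"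
      unfolding c[OF \<open>j \<in> J\<close>] using S by (intro smult_finsum) auto
    also have "\<dots> = (\<Oplus>s\<in>S. (\<alpha> j * c j s) \<odot> s)"
      using S by (intro finsum_cong') (auto simp: smult_smult)
    finally show "\<alpha> j \<odot> v j = (\<Oplus>s\<in>S. (\<alpha> j * c j s) \<odot> s)" .
  qed (use S in \<open>auto intro!: finsum_closed\<close>)
  also have "\<dots> = (\<Oplus>s\<in>S. \<Oplus>j\<in>J. (\<alpha> j * c j s) \<odot> s)"
    using S J by (intro finsum_swap) auto
  also have "\<dots> = (\<Oplus>s\<in>S. \<zero>)"
    using S J \<alpha>(2) by (intro finsum_cong') (auto simp: sum_smult)
  finally show ?thesis
    using \<alpha>(1) by auto
qed

end

text \<open>The C*-identity enters the search for projections through this fact: it keeps y^* y and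
  its square nonzero.\<close>

lemma (in cstar_algebra) star_mult_self_eq_zero:
  assumes "x \<in> carrier A" "star A x \<otimes> x = \<zero>"
  shows "x = \<zero>"
  using cstar_identity[OF assms(1)] nrm_eq_zero[OF assms(1)] nrm_eq_zero[OF zero_closed] assms(2)
  by simp

text \<open>Let \<open>y = g(x)\<close>, where \<open>(X - \<mu>) g\<close> is the minimal polynomial of \<open>x\<close> in the corner of \<open>q\<close>.
  Then \<open>x y = \<mu> y\<close>, so \<open>y\<^sup>* y\<close> is a multiple of \<open>y\<close>, and a multiple of it is an eigenprojection.\<close>

lemma (in fd_cstar_algebra) proper_subprojection:
  assumes q: "projection q"
    and x: "x \<in> carrier A" "star A x = x" "q \<otimes> x = x" "x \<otimes> q = x"
    and not_scalar: "\<And>c. x \<noteq> c \<odot> q"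
  shows "\<exists>e. projection e \<and> e \<noteq> \<zero> \<and> e \<noteq> q \<and> q \<otimes> e = e \<and> e \<otimes> q = e"
proof -
  have qc [simp]: "q \<in> carrier A" "q \<otimes> q = q" "star A q = q"
    using q by (auto simp: projection_def)
  have "q \<noteq> \<zero>"
    using not_scalar[of 0] x by auto
  note [simp] = x
  \<comment> \<open>Horner evaluation of p at x in the corner of q, whose unit is q.\<close>
  define ev where "ev p = fold_coeffs (\<lambda>a y. a \<odot> q \<oplus> x \<otimes> y) p \<zero>" for p
  have ev_0 [simp]: "ev 0 = \<zero>"
    by (simp add: ev_def)
  have ev_pCons: "ev (pCons a p) = a \<odot> q \<oplus> x \<otimes> ev p" for a p
    by (cases "a = 0 \<and> p = 0") (auto simp: ev_def)
  have ev_closed [simp]: "ev p \<in> carrier A" for p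
    by (induction p) (auto simp: ev_pCons)
  have q_ev [simp]: "q \<otimes> ev p = ev p" for p
    by (induction p) (auto simp: ev_pCons r_distr smult_mult_right m_assoc[symmetric])
  have ev_q [simp]: "ev p \<otimes> q = ev p" for p
    by (induction p) (auto simp: ev_pCons l_distr smult_mult_left m_assoc)
  have ev_add: "ev (p + r) = ev p \<oplus> ev r" for p r
  proof (induction p r rule: poly_induct2)
    case (pCons a p b r)
    then show ?case
      by (simp add: ev_pCons smult_add_left r_distr a_ac)
  qed simp
  have ev_smult: "ev (Polynomial.smult c p) = c \<odot> ev p" for c p
    by (induction p) (auto simp: ev_pCons smult_add_right smult_smult smult_mult_right)
  have ev_sum: "ev (\<Sum>i\<in>I. f i) = (\<Oplus>i\<in>I. ev (f i))" if "finite I" for I :: "nat set" and f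
    using that by (induction I rule: finite_induct) (auto simp: ev_add)
  have "\<exists>p. p \<noteq> 0 \<and> ev p = \<zero>"
  proof -
    obtain S where S: "finite S" "S \<subseteq> carrier A" "\<forall>x\<in>carrier A. \<exists>c. x = (\<Oplus>s\<in>S. c s \<odot> s)"
      using finite_dim by blast
    obtain \<alpha> i where \<alpha>: "i \<in> {..card S}" "\<alpha> i \<noteq> 0"
      "(\<Oplus>j\<in>{..card S}. \<alpha> j \<odot> ev (Polynomial.monom 1 j)) = \<zero>"
      using linear_dependence[OF S, of "{..card S}" "\<lambda>j. ev (Polynomial.monom 1 j)"] by auto
    let ?p = "\<Sum>j\<le>card S. Polynomial.smult (\<alpha> j) (Polynomial.monom 1 j)"
    have "Polynomial.coeff ?p i = \<alpha> i"
      using \<alpha>(1) by (simp add: coeff_sum if_distrib cong: if_cong)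
    then have "?p \<noteq> 0"
      using \<alpha>(2) by auto
    moreover have "ev ?p = \<zero>"
      using \<alpha>(3) by (simp add: ev_sum ev_smult)
    ultimately show ?thesis
      by blast
  qed
  then obtain p where p: "p \<noteq> 0" "ev p = \<zero>"
    and least: "\<And>r. r \<noteq> 0 \<Longrightarrow> ev r = \<zero> \<Longrightarrow> Polynomial.degree p \<le> Polynomial.degree r"
    using ex_has_least_nat[of "\<lambda>p. p \<noteq> 0 \<and> ev p = \<zero>" _ Polynomial.degree] by blast
  have "Polynomial.degree p \<noteq> 0"
  proof
    assume "Polynomial.degree p = 0"
    then obtain a where a: "p = [:a:]"
      by (rule degree_eq_zeroE)
    then show False
      using p \<open>q \<noteq> \<zero>\<close> by (simp add: ev_pCons smult_eq_zero_iff)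
  qed
  then obtain \<mu> where "poly p \<mu> = 0"
    using fundamental_theorem_of_algebra[of p] by (auto simp: constant_degree)
  then obtain g where g: "p = [:- \<mu>, 1:] * g"
    by (auto simp: poly_eq_0_iff_dvd elim: dvdE)
  have "g \<noteq> 0"
    using g p by auto
  have "Polynomial.degree g < Polynomial.degree p"
    unfolding g using \<open>g \<noteq> 0\<close> by (subst degree_mult_eq) auto
  define y where "y = ev g"
  have y [simp]: "y \<in> carrier A" "q \<otimes> y = y" "y \<otimes> q = y"
    by (auto simp: y_def)
  have "y \<noteq> \<zero>"
    using least[OF \<open>g \<noteq> 0\<close>] \<open>Polynomial.degree g < Polynomial.degree p\<close> by (auto simp: y_def)
  have "p = Polynomial.smult (- \<mu>) g + pCons 0 g"
    by (simp add: g)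
  then have "ev p = (- \<mu>) \<odot> y \<oplus> (0 \<odot> q \<oplus> x \<otimes> y)"
    by (simp only: ev_add ev_smult ev_pCons y_def)
  then have "\<ominus> (\<mu> \<odot> y) \<oplus> x \<otimes> y = \<zero>"
    using p(2) by (simp add: minus_smult)
  then have xy: "x \<otimes> y = \<mu> \<odot> y"
    using add.inv_equality minus_equality by (metis a_comm a_inv_closed m_closed minus_minus smult_in_carrier x(1) y(1))
  have ev_y: "ev r \<otimes> y = poly r \<mu> \<odot> y" for r
  proof (induction r)
    case (pCons a r)
    have "ev (pCons a r) \<otimes> y = a \<odot> y \<oplus> x \<otimes> (ev r \<otimes> y)"
      by (simp add: ev_pCons l_distr smult_mult_left m_assoc)
    then show ?case
      by (simp add: pCons smult_mult_right xy smult_smult smult_add_left mult.commute)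
  qed simp
  \<comment> \<open>As x is self-adjoint, the adjoint of ev r is again a polynomial in x, hence acts
    on the eigenvector y as a scalar. For r = g this makes y^* y a multiple of y.\<close>
  have "\<exists>\<nu>. star A (ev r) \<otimes> y = \<nu> \<odot> y" for r
  proof (induction r)
    case 0
    then show ?case
      by (auto intro!: exI[of _ 0])
  next
    case (pCons a r)
    then obtain \<nu> where \<nu>: "star A (ev r) \<otimes> y = \<nu> \<odot> y"
      by blast
    have "star A (ev (pCons a r)) \<otimes> y = cnj a \<odot> y \<oplus> star A (ev r) \<otimes> (x \<otimes> y)"
      by (simp add: ev_pCons star_add star_smult star_mult l_distr smult_mult_left m_assoc)
    also have "\<dots> = (cnj a + \<mu> * \<nu>) \<odot> y"
      by (simp add: xy smult_mult_right \<nu> smult_smult smult_add_left)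
    finally show ?case
      by blast
  qed
  then obtain \<nu> where \<nu>: "star A y \<otimes> y = \<nu> \<odot> y"
    unfolding y_def by blast
  define h where "h = \<nu> \<odot> y"
  have h [simp]: "h \<in> carrier A" "q \<otimes> h = h" "h \<otimes> q = h"
    by (simp_all add: h_def smult_mult_right smult_mult_left)
  have [simp]: "star A h = h"
    unfolding h_def \<nu>[symmetric] by (simp add: star_mult)
  have "h \<noteq> \<zero>"
    using \<nu> star_mult_self_eq_zero[OF y(1)] \<open>y \<noteq> \<zero>\<close> by (auto simp: h_def)
  define \<kappa> where "\<kappa> = \<nu> * poly g \<mu>"
  have "h \<otimes> h = (\<nu> * \<nu>) \<odot> (y \<otimes> y)"
    by (simp add: h_def smult_mult_left smult_mult_right smult_smult)
  also have "y \<otimes> y = poly g \<mu> \<odot> y"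
    using ev_y[of g] by (simp add: y_def)
  finally have hh: "h \<otimes> h = \<kappa> \<odot> h"
    by (simp add: h_def \<kappa>_def smult_smult mult_ac)
  \<comment> \<open>h is self-adjoint and nonzero, so h h = h^* h is nonzero.\<close>
  have "\<kappa> \<noteq> 0"
    using hh star_mult_self_eq_zero[OF h(1)] \<open>h \<noteq> \<zero>\<close> by auto
  have "cnj \<kappa> \<odot> h = star A (h \<otimes> h)"
    by (simp add: hh star_smult)
  also have "\<dots> = \<kappa> \<odot> h"
    by (subst star_mult) (simp_all add: hh)
  finally have \<kappa>: "cnj \<kappa> = \<kappa>"
    using smult_cancel_right \<open>h \<noteq> \<zero>\<close> h(1) by blast
  define e where "e = inverse \<kappa> \<odot> h"
  have "projection e"
    using \<open>\<kappa> \<noteq> 0\<close>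
    by (simp add: projection_def e_def star_smult \<kappa> smult_mult_left smult_mult_right hh smult_smult)
  moreover have "e \<noteq> \<zero>"
    using \<open>\<kappa> \<noteq> 0\<close> \<open>h \<noteq> \<zero>\<close> by (simp add: e_def smult_eq_zero_iff)
  moreover have qe: "q \<otimes> e = e" "e \<otimes> q = e"
    by (simp_all add: e_def smult_mult_left smult_mult_right)
  moreover have "x \<otimes> e = \<mu> \<odot> e"
    by (simp add: e_def h_def smult_mult_right xy smult_smult mult_ac)
  \<comment> \<open>If e = q, then x = x q = \<mu> q would be scalar.\<close>
  then have "e \<noteq> q"
    using not_scalar[of \<mu>] x(4) by auto
  ultimately show ?thesis
    by blast
qed

text \<open>Take a resolution with as many nonzero members as possible. A nonscalar self-adjoint
  element in the corner of some q would split q into two nonzero projections and give a longer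
  resolution.\<close>

lemma (in fd_cstar_algebra) minimal_resolution:
  obtains P where "orthogonal_resolution A P (\<lambda>p. p)"
    and "\<And>p b. p \<in> P \<Longrightarrow> b \<in> carrier A \<Longrightarrow> \<exists>c. p \<otimes> b \<otimes> p = c \<odot> p"
proof -
  let ?R = "\<lambda>P. orthogonal_resolution A P (\<lambda>p. p) \<and> \<zero> \<notin> P"
  obtain S where S: "finite S" "S \<subseteq> carrier A" "\<forall>x\<in>carrier A. \<exists>c. x = (\<Oplus>s\<in>S. c s \<odot> s)"
    using finite_dim by blast
  have bound: "card P \<le> card S" if "?R P" for P
  proof (rule ccontr)
    interpret P: orthogonal_resolution A P "\<lambda>p. p"
      using that by blast
    assume "\<not> card P \<le> card S"
    then obtain \<alpha> p where "p \<in> P" "\<alpha> p \<noteq> 0" "(\<Oplus>p\<in>P. \<alpha> p \<odot> p) = \<zero>"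
      using linear_dependence[OF S, of P "\<lambda>p. p"] P.finite_index P.q_closed by auto
    then have "\<alpha> p \<odot> p = \<zero>"
      using P.diagonal_mult_q[of p \<alpha>] P.q_closed by (simp add: P.diagonal_def)
    then show False
      using \<open>p \<in> P\<close> \<open>\<alpha> p \<noteq> 0\<close> that P.q_closed by (auto simp: smult_eq_zero_iff)
  qed
  \<comment> \<open>The set difference covers the zero algebra, where 1 = 0 and the resolution is
    empty.\<close>
  have "?R ({\<one>} - {\<zero>})"
    by (auto simp: orthogonal_resolution_def orthogonal_resolution_axioms_def star_algebra_axioms
        insert_Diff_if)
  then obtain P where P: "?R P" and max: "\<And>Q. ?R Q \<Longrightarrow> card Q \<le> card P"
    using ex_has_greatest_nat[of ?R _ card "Suc (card S)"] bound by (metis less_Suc_eq_le)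
  interpret P: orthogonal_resolution A P "\<lambda>p. p"
    using P by blast
  have proj: "projection p" if "p \<in> P" for p
    using that P.q_closed P.q_idem P.q_star by (auto simp: projection_def)
  have scalar: "\<exists>c. x = c \<odot> q"
    if q: "q \<in> P" and x: "x \<in> carrier A" "star A x = x" "q \<otimes> x = x" "x \<otimes> q = x" for q x
  proof (rule ccontr)
    assume "\<nexists>c. x = c \<odot> q"
    then obtain e where e: "projection e" "e \<noteq> \<zero>" "e \<noteq> q" "q \<otimes> e = e" "e \<otimes> q = e"
      using proper_subprojection[OF proj[OF q] x] by auto
    have c: "q \<in> carrier A" "e \<in> carrier A" "e \<otimes> e = e" "star A e = e" "q \<otimes> q = q" "star A q = q"
      using e(1) proj[OF q] by (auto simp: projection_def)
    define f where "f = q \<ominus> e"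
    have f: "f \<in> carrier A" "f \<otimes> f = f" "star A f = f" "q \<otimes> f = f" "f \<otimes> q = f"
      "e \<otimes> f = \<zero>" "f \<otimes> e = \<zero>"
      using c e by (simp_all add: f_def star_add star_uminus a_minus_def l_distr r_distr l_minus r_minus r_neg
          minus_add minus_minus)
    have qef: "q = e \<oplus> f"
      unfolding f_def using c by (intro eq_add_diff)
    have "f \<noteq> \<zero>"
      using qef e c by auto
    have orth: "r \<otimes> s = \<zero> \<and> s \<otimes> r = \<zero>" if "r \<in> carrier A" "q \<otimes> r = r" "r \<otimes> q = r" "s \<in> P - {q}" for r s
    proof -
      have s: "s \<in> carrier A" "s \<otimes> q = \<zero>" "q \<otimes> s = \<zero>"
        using that q P.q_closed P.q_orth by auto
      then show ?thesis
        using that c m_assoc[of r q s] m_assoc[of s q r] by simp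
    qed
    \<comment> \<open>The resolution is a set of projections, so the pieces e and f must be new
      elements for the cardinality to grow.\<close>
    have notin: "r \<notin> P - {q}" if "r \<in> carrier A" "q \<otimes> r = r" "r \<otimes> q = r" "r \<otimes> r = r" "r \<noteq> \<zero>" for r
      using orth[of r r] that by auto
    have "e \<noteq> f"
      using f c e by auto
    have sum: "q \<oplus> (\<Oplus>p\<in>P - {q}. p) = \<one>"
    proof -
      have "(\<Oplus>p\<in>insert q (P - {q}). p) = q \<oplus> (\<Oplus>p\<in>P - {q}. p)"
        using P.finite_index P.q_closed q by (intro finsum_insert) auto
      then show ?thesis
        using P.q_sum q by (simp add: insert_absorb)
    qed
    define Q where "Q = insert e (insert f (P - {q}))"
    have ef: "e \<notin> P - {q}" "f \<notin> P - {q}"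
      using notin[of e] notin[of f] c e f \<open>f \<noteq> \<zero>\<close> by auto
    have "orthogonal_resolution A Q (\<lambda>p. p)"
    proof
      show "finite Q"
        using P.finite_index by (simp add: Q_def)
      show "p \<in> carrier A" "star A p = p" "p \<otimes> p = p" if "p \<in> Q" for p
        using that c f P.q_closed P.q_star P.q_idem by (auto simp: Q_def)
      show "i \<otimes> j = \<zero>" if "i \<in> Q" "j \<in> Q" "i \<noteq> j" for i j
        using that orth[of e] orth[of f] c e f P.q_orth by (auto simp: Q_def)
      have rest: "(\<Oplus>p\<in>P - {q}. p) \<in> carrier A"
        using P.q_closed by (intro finsum_closed) auto
      have "(\<Oplus>p\<in>Q. p) = e \<oplus> (f \<oplus> (\<Oplus>p\<in>P - {q}. p))"
        unfolding Q_def using P.finite_index P.q_closed ef c f \<open>e \<noteq> f\<close>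
        by (subst finsum_insert | auto)+
      also have "\<dots> = \<one>"
        using sum c f rest by (simp add: qef a_assoc)
      finally show "(\<Oplus>p\<in>Q. p) = \<one>" .
    qed
    moreover have "\<zero> \<notin> Q"
      using P e \<open>f \<noteq> \<zero>\<close> by (auto simp: Q_def)
    moreover have "card Q = Suc (card P)"
      using ef \<open>e \<noteq> f\<close> P.finite_index q card_Suc_Diff1[of P q] by (simp add: Q_def)
    ultimately show False
      using max[of Q] by simp
  qed
  have "\<exists>c. p \<otimes> b \<otimes> p = c \<odot> p" if p: "p \<in> P" and b: "b \<in> carrier A" for p b
  proof -
    define u where "u = p \<otimes> b \<otimes> p"
    have pp: "p \<in> carrier A" "p \<otimes> p = p" "star A p = p"
      using proj[OF p] by (auto simp: projection_def)
    have u: "u \<in> carrier A" "p \<otimes> u = u" "u \<otimes> p = u"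
      using pp b by (simp_all add: u_def m_assoc) (simp flip: m_assoc)
    have us: "p \<otimes> star A u = star A u" "star A u \<otimes> p = star A u"
      using u pp by (metis star_mult)+
    \<comment> \<open>\<open>scalar\<close> covers self-adjoint elements only, so it is applied to u
      + u^* and to \<i> (u - u^* ), from which 2 u is recovered.\<close>
    obtain c where c: "u \<oplus> star A u = c \<odot> p"
      using scalar[OF p, of "u \<oplus> star A u"] u us pp
      by (auto simp: star_add l_distr r_distr a_comm)
    obtain d where d: "\<i> \<odot> u \<oplus> (- \<i>) \<odot> star A u = d \<odot> p"
      using scalar[OF p, of "\<i> \<odot> u \<oplus> (- \<i>) \<odot> star A u"] u us pp
      by (auto simp: star_add star_smult l_distr r_distr smult_mult_left smult_mult_right a_comm)
    have "u \<oplus> star A u \<oplus> (- \<i>) \<odot> (\<i> \<odot> u \<oplus> (- \<i>) \<odot> star A u) = 2 \<odot> u"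
    proof -
      have "(- \<i>) \<odot> (\<i> \<odot> u \<oplus> (- \<i>) \<odot> star A u) = u \<oplus> \<ominus> star A u"
        using u by (simp only: smult_add_right smult_smult smult_in_carrier star_closed)
          (simp add: minus_smult)
      moreover have "2 \<odot> u = u \<oplus> u"
        using u smult_add_left[of u 1 1] by simp
      ultimately show ?thesis
        using u by (simp add: a_assoc a_lcomm[of "star A u" u] r_neg)
    qed
    then have "2 \<odot> u = (c + - \<i> * d) \<odot> p"
      unfolding c d using pp by (simp only: smult_smult smult_add_left)
    then have "(1/2) \<odot> (2 \<odot> u) = (1/2) \<odot> ((c + - \<i> * d) \<odot> p)"
      by simp
    then have "u = (1/2 * (c + - \<i> * d)) \<odot> p"
      using u pp by (simp add: smult_smult)
    then show ?thesis
      unfolding u_def by blast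
  qed
  then show thesis
    using that[of P] P by blast
qed

section \<open>Existence of Bayesian inverses\<close>

text \<open>The assumption \<open>comm\<close> makes b \<mapsto> \<omega>(a F(b)) tracial. It holds
  if B is commutative, and also if F is a.e. deterministic into a commutative A.\<close>

lemma bayesian_inverse_exists:
  assumes "bayes A B F \<omega>" "fd_cstar_algebra B" "cring A"
    and comm: "\<And>a b c. a \<in> carrier A \<Longrightarrow> b \<in> carrier B \<Longrightarrow> c \<in> carrier B \<Longrightarrow>
      \<omega> (a \<otimes>\<^bsub>A\<^esub> F (b \<otimes>\<^bsub>B\<^esub> c)) = \<omega> (a \<otimes>\<^bsub>A\<^esub> F (c \<otimes>\<^bsub>B\<^esub> b))"
  shows "\<exists>G. cpu_bayesian_inverse B A F \<omega> (\<omega> \<circ> F) G"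
proof -
  interpret bayes A B F \<omega> by fact
  interpret B: fd_cstar_algebra B by fact
  interpret A: cring A by fact
  obtain P where "orthogonal_resolution B P (\<lambda>p. p)"
    and scalar: "\<And>p b. p \<in> P \<Longrightarrow> b \<in> carrier B \<Longrightarrow> \<exists>c. p \<otimes>\<^bsub>B\<^esub> b \<otimes>\<^bsub>B\<^esub> p = c \<odot>\<^bsub>B\<^esub> p"
    using B.minimal_resolution by blast
  interpret P: orthogonal_resolution B P "\<lambda>p. p" by fact
  note P [simp] = P.q_closed P.q_idem P.q_star
  have \<omega>_lin: "linear_functional A \<omega>"
    using \<omega>_pos by (simp add: positive_functional_def)
  \<comment> \<open>Commutativity of A makes \<omega>(a^* a - ) a positive functional, which is then
    composed with F and evaluated at p = p^* p.\<close>
  have pos: "\<omega> (star A a \<otimes>\<^bsub>A\<^esub> a \<otimes>\<^bsub>A\<^esub> F p) \<in> \<real>\<^sub>\<ge>\<^sub>0" if a: "a \<in> carrier A" and p: "p \<in> P" for a p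
  proof -
    define \<psi> where "\<psi> x = \<omega> (star A a \<otimes>\<^bsub>A\<^esub> a \<otimes>\<^bsub>A\<^esub> x)" for x
    have "linear_functional A \<psi>"
      using a by (auto simp: \<psi>_def linear_functional_def linear_map_def A.r_distr A.smult_mult_right
          A.functional_add[OF \<omega>_lin] A.functional_smult[OF \<omega>_lin])
    moreover have "\<psi> (star A x \<otimes>\<^bsub>A\<^esub> x) \<in> \<real>\<^sub>\<ge>\<^sub>0" if x: "x \<in> carrier A" for x
    proof -
      have "star A a \<otimes>\<^bsub>A\<^esub> a \<otimes>\<^bsub>A\<^esub> (star A x \<otimes>\<^bsub>A\<^esub> x) = star A (x \<otimes>\<^bsub>A\<^esub> a) \<otimes>\<^bsub>A\<^esub> (x \<otimes>\<^bsub>A\<^esub> a)"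
        using a x by (simp add: A.star_mult A.m_ac)
      then show ?thesis
        using \<omega>_pos a x by (simp add: \<psi>_def positive_functional_def)
    qed
    ultimately have "positive_functional B (\<psi> \<circ> F)"
      by (intro positive_functional_comp) (simp add: positive_functional_def)
    then have "(\<psi> \<circ> F) (star B p \<otimes>\<^bsub>B\<^esub> p) \<in> \<real>\<^sub>\<ge>\<^sub>0"
      unfolding positive_functional_def using P.q_closed p by blast
    then show ?thesis
      using p by (simp add: \<psi>_def)
  qed
  have \<xi>_nonneg: "\<xi> p \<in> \<real>\<^sub>\<ge>\<^sub>0" if "p \<in> P" for p
    using pos[OF A.one_closed that] that by (simp add: \<xi>_def)
  \<comment> \<open>By Kadison--Schwarz, 0 \<le> \<omega>(F(p)^* F(p)) \<le> \<xi>(p) = 0.\<close>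
  have null: "\<omega> (a \<otimes>\<^bsub>A\<^esub> F p) = 0" if "a \<in> carrier A" "p \<in> P" "\<xi> p = 0" for a p
  proof (rule A.functional_null[OF \<omega>_pos])
    have "\<omega> (star A (F p) \<otimes>\<^bsub>A\<^esub> F p) \<in> \<real>\<^sub>\<ge>\<^sub>0"
      using \<omega>_pos that by (simp add: positive_functional_def)
    then show "\<omega> (star A (F p) \<otimes>\<^bsub>A\<^esub> F p) = 0"
      using schwarz(1)[OF \<omega>_pos, of p] that
      by (auto simp: \<xi>_def complex_nonneg_Reals_iff complex_eq_iff)
  qed (use that in auto)
  \<comment> \<open>On null projections the value is invisible to \<xi>; \<omega> keeps \<phi> p a
    state there, so that the map stays unital and positive.\<close>
  define \<phi> where "\<phi> p a = (if \<xi> p = 0 then \<omega> a else \<omega> (a \<otimes>\<^bsub>A\<^esub> F p) / \<xi> p)" for p a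
  have "state A (\<phi> p)" if p: "p \<in> P" for p
    unfolding state_iff
  proof
    show "positive_functional A (\<phi> p)"
      using p pos[OF _ p] \<xi>_nonneg[OF p] \<omega>_pos
      by (auto simp: \<phi>_def positive_functional_def linear_functional_def linear_map_def A.l_distr
          A.smult_mult_left A.functional_add[OF \<omega>_lin] A.functional_smult[OF \<omega>_lin] add_divide_distrib)
  qed (use p in \<open>simp add: \<phi>_def \<xi>_def\<close>)
  then have cpu: "cpu_map A B (\<lambda>a. P.diagonal (\<lambda>p. \<phi> p a))"
    by (intro P.cpu_map_diagonal A.star_algebra_axioms)
  have "\<xi> (P.diagonal (\<lambda>p. \<phi> p a) \<otimes>\<^bsub>B\<^esub> b) = \<omega> (a \<otimes>\<^bsub>A\<^esub> F b)" if a: "a \<in> carrier A" and b: "b \<in> carrier B" for a b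
  proof -
    obtain c where c: "\<And>p. p \<in> P \<Longrightarrow> p \<otimes>\<^bsub>B\<^esub> b \<otimes>\<^bsub>B\<^esub> p = c p \<odot>\<^bsub>B\<^esub> p"
      using scalar[OF _ b] by metis
    have compress: "\<omega> (a' \<otimes>\<^bsub>A\<^esub> F (p \<otimes>\<^bsub>B\<^esub> b)) = c p * \<omega> (a' \<otimes>\<^bsub>A\<^esub> F p)"
      if "a' \<in> carrier A" "p \<in> P" for a' p
    proof -
      \<comment> \<open>Doubling p lets \<open>comm\<close> move one copy to the right, and
        minimality of p makes p b p scalar.\<close>
      have "\<omega> (a' \<otimes>\<^bsub>A\<^esub> F (p \<otimes>\<^bsub>B\<^esub> b)) = \<omega> (a' \<otimes>\<^bsub>A\<^esub> F (p \<otimes>\<^bsub>B\<^esub> (p \<otimes>\<^bsub>B\<^esub> b)))"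
        using that b by (simp flip: B.m_assoc)
      also have "\<dots> = \<omega> (a' \<otimes>\<^bsub>A\<^esub> F (p \<otimes>\<^bsub>B\<^esub> b \<otimes>\<^bsub>B\<^esub> p))"
        using that b by (intro comm) auto
      also have "\<dots> = c p * \<omega> (a' \<otimes>\<^bsub>A\<^esub> F p)"
        using that by (simp add: c linear_map_smult[OF linear] A.smult_mult_right
            A.functional_smult[OF \<omega>_lin])
      finally show ?thesis .
    qed
    have "\<xi> (P.diagonal (\<lambda>p. \<phi> p a) \<otimes>\<^bsub>B\<^esub> b) = \<xi> (\<Oplus>\<^bsub>B\<^esub>p\<in>P. (\<phi> p a \<odot>\<^bsub>B\<^esub> p) \<otimes>\<^bsub>B\<^esub> b)"
      unfolding P.diagonal_def using P.finite_index b by (subst B.finsum_ldistr) auto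
    also have "\<dots> = (\<Sum>p\<in>P. \<phi> p a * \<xi> (p \<otimes>\<^bsub>B\<^esub> b))"
      using P.finite_index b
      by (subst B.functional_finsum[OF \<xi>_lin]) (auto simp: B.smult_mult_left B.functional_smult[OF \<xi>_lin])
    also have "\<dots> = (\<Sum>p\<in>P. \<omega> (a \<otimes>\<^bsub>A\<^esub> F (p \<otimes>\<^bsub>B\<^esub> b)))"
    proof (intro sum.cong refl)
      fix p assume p: "p \<in> P"
      have "\<xi> (p \<otimes>\<^bsub>B\<^esub> b) = c p * \<xi> p"
        using compress[OF A.one_closed p] p b by (simp add: \<xi>_def)
      then show "\<phi> p a * \<xi> (p \<otimes>\<^bsub>B\<^esub> b) = \<omega> (a \<otimes>\<^bsub>A\<^esub> F (p \<otimes>\<^bsub>B\<^esub> b))"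
        using null[OF a p] by (simp add: compress[OF a p] \<phi>_def)
    qed
    also have "\<dots> = \<omega> (a \<otimes>\<^bsub>A\<^esub> F (\<Oplus>\<^bsub>B\<^esub>p\<in>P. p \<otimes>\<^bsub>B\<^esub> b))"
      using P.finite_index a b
      by (subst linear_map_finsum[OF B.star_algebra_axioms A.star_algebra_axioms linear], simp, force,
          subst A.finsum_rdistr, simp, simp, force, subst A.functional_finsum[OF \<omega>_lin]) auto
    also have "(\<Oplus>\<^bsub>B\<^esub>p\<in>P. p \<otimes>\<^bsub>B\<^esub> b) = (\<Oplus>\<^bsub>B\<^esub>p\<in>P. p) \<otimes>\<^bsub>B\<^esub> b"
      using P.finite_index b by (intro B.finsum_ldistr[symmetric]) auto
    finally show ?thesis
      using b by (simp add: P.q_sum)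
  qed
  then have "cpu_bayesian_inverse B A F \<omega> \<xi> (\<lambda>a. P.diagonal (\<lambda>p. \<phi> p a))"
    using cpu by (simp add: cpu_bayesian_inverse_def)
  then show ?thesis
    unfolding \<xi>_def by blast
qed

lemma bayes_data_consequences:
  assumes data: "bayes_data B A F \<omega>" and \<xi>: "\<xi> = \<omega> \<circ> F"
  shows "cpu_bayesian_inverse B A F \<omega> \<xi> G \<Longrightarrow> cpu_bayesian_inverse B A F \<omega> \<xi> G' \<Longrightarrow>
      ae_equiv A B \<xi> G G'"
    and "cpu_bayesian_inverse B A F \<omega> \<xi> G \<Longrightarrow>
      ae_deterministic B A F \<omega> \<longleftrightarrow> cpu_disintegration B A F \<omega> \<xi> G"
    and "cpu_disintegration B A F \<omega> \<xi> G \<Longrightarrow> ae_deterministic B A F \<omega>"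
    and "cpu_disintegration B A F \<omega> \<xi> G \<Longrightarrow> cpu_bayesian_inverse B A F \<omega> \<xi> G"
    and "cring A \<Longrightarrow> ae_deterministic B A F \<omega> \<Longrightarrow> \<exists>G. cpu_disintegration B A F \<omega> \<xi> G"
    and "cring A \<Longrightarrow> cring B \<Longrightarrow> \<exists>G. cpu_bayesian_inverse B A F \<omega> \<xi> G"
proof -
  interpret A: fd_cstar_algebra A
    using data by (simp add: bayes_data_def)
  interpret B: fd_cstar_algebra B
    using data by (simp add: bayes_data_def)
  interpret bayes A B F \<omega>
    using data by unfold_locales (simp_all add: bayes_data_def)
  note \<xi>_eq = \<xi>[folded \<xi>_def]
  show "cpu_bayesian_inverse B A F \<omega> \<xi> G \<Longrightarrow> cpu_bayesian_inverse B A F \<omega> \<xi> G' \<Longrightarrow>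
      ae_equiv A B \<xi> G G'"
    unfolding \<xi>_eq by (rule bayesian_inverse_unique)
  show iff: "ae_deterministic B A F \<omega> \<longleftrightarrow> cpu_disintegration B A F \<omega> \<xi> G"
    if "cpu_bayesian_inverse B A F \<omega> \<xi> G" for G
    using that unfolding \<xi>_eq by (rule ae_deterministic_iff_disintegration)
  show "cpu_disintegration B A F \<omega> \<xi> G \<Longrightarrow> ae_deterministic B A F \<omega>"
    unfolding \<xi>_eq by (rule disintegration_imp)
  show "cpu_disintegration B A F \<omega> \<xi> G \<Longrightarrow> cpu_bayesian_inverse B A F \<omega> \<xi> G"
    unfolding \<xi>_eq by (rule disintegration_imp)
  show "\<exists>G. cpu_disintegration B A F \<omega> \<xi> G" if A: "cring A" and det: "ae_deterministic B A F \<omega>"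
  proof -
    interpret A: cring A by fact
    have "\<exists>G. cpu_bayesian_inverse B A F \<omega> (\<omega> \<circ> F) G"
    proof (rule bayesian_inverse_exists[OF bayes_axioms B.fd_cstar_algebra_axioms A])
      fix a b c assume abc: "a \<in> carrier A" "b \<in> carrier B" "c \<in> carrier B"
      have "\<omega> (a \<otimes>\<^bsub>A\<^esub> F (b \<otimes>\<^bsub>B\<^esub> c)) = \<omega> (a \<otimes>\<^bsub>A\<^esub> F b \<otimes>\<^bsub>A\<^esub> F c)"
        using det abc by (simp add: ae_deterministic_def)
      also have "\<dots> = \<omega> (a \<otimes>\<^bsub>A\<^esub> F c \<otimes>\<^bsub>A\<^esub> F b)"
        using abc by (simp add: A.m_ac)
      also have "\<dots> = \<omega> (a \<otimes>\<^bsub>A\<^esub> F (c \<otimes>\<^bsub>B\<^esub> b))"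
        using det abc by (simp add: ae_deterministic_def)
      finally show "\<omega> (a \<otimes>\<^bsub>A\<^esub> F (b \<otimes>\<^bsub>B\<^esub> c)) = \<omega> (a \<otimes>\<^bsub>A\<^esub> F (c \<otimes>\<^bsub>B\<^esub> b))" .
    qed
    then show ?thesis
      using iff det \<xi> by blast
  qed
  show "\<exists>G. cpu_bayesian_inverse B A F \<omega> \<xi> G" if A: "cring A" and B: "cring B"
    unfolding \<xi>
    by (rule bayesian_inverse_exists[OF bayes_axioms B.fd_cstar_algebra_axioms A])
      (simp add: cring.cring_simprules(14)[OF B])
qed

section \<open>The two-by-two matrices and their diagonal subalgebra\<close>

lemma cring_complex_algebra: "cring complex_algebra"
proof (intro cringI abelian_groupI comm_monoidI)
  fix x :: complex
  show "\<exists>y\<in>carrier complex_algebra. y \<oplus>\<^bsub>complex_algebra\<^esub> x = \<zero>\<^bsub>complex_algebra\<^esub>"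
    by (auto intro!: exI[of _ "- x"])
qed (simp_all add: algebra_simps)

text \<open>The argument \<open>d\<close> restricts to diagonal matrices. The operations discard off-diagonal
  entries in that case even outside of the carrier, because \<^const>\<open>Metric_space\<close> requires
  symmetry of the distance on the whole type.\<close>

definition mat2 :: "bool \<Rightarrow> complex \<Rightarrow> complex \<Rightarrow> complex \<Rightarrow> complex \<Rightarrow> nat \<times> nat \<Rightarrow> complex" where
  "mat2 d a b c e = (\<lambda>p. if p = (0, 0) then a else if p = (1, 1) then e else if d then 0
     else if p = (0, 1) then b else if p = (1, 0) then c else 0)"

text \<open>The action on column vectors. The norm of a pair is Euclidean, so \<open>onorm\<close>
  of this map is the usual C*-norm of a matrix.\<close>

definition mat2_op :: "(nat \<times> nat \<Rightarrow> complex) \<Rightarrow> complex \<times> complex \<Rightarrow> complex \<times> complex" where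
  "mat2_op x w = (x (0, 0) * fst w + x (0, 1) * snd w, x (1, 0) * fst w + x (1, 1) * snd w)"

definition mat2_algebra :: "bool \<Rightarrow> matrix_algebra" where
  "mat2_algebra d =
     \<lparr>carrier = {x. \<exists>a b c e. x = mat2 d a b c e},
      mult = (\<lambda>x y. mat2 d
        (x (0, 0) * y (0, 0) + x (0, 1) * y (1, 0)) (x (0, 0) * y (0, 1) + x (0, 1) * y (1, 1))
        (x (1, 0) * y (0, 0) + x (1, 1) * y (1, 0)) (x (1, 0) * y (0, 1) + x (1, 1) * y (1, 1))),
      one = mat2 d 1 0 0 1,
      ring.zero = mat2 d 0 0 0 0,
      add = (\<lambda>x y. mat2 d (x (0, 0) + y (0, 0)) (x (0, 1) + y (0, 1))
        (x (1, 0) + y (1, 0)) (x (1, 1) + y (1, 1))),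
      smult = (\<lambda>t x. mat2 d (t * x (0, 0)) (t * x (0, 1)) (t * x (1, 0)) (t * x (1, 1))),
      star = (\<lambda>x. mat2 d (cnj (x (0, 0))) (cnj (x (1, 0))) (cnj (x (0, 1))) (cnj (x (1, 1)))),
      nrm = (\<lambda>x. onorm (mat2_op x))\<rparr>"

lemma mat2_entries [simp]:
  "mat2 d a b c e (0, 0) = a" "mat2 d a b c e (0, Suc 0) = (if d then 0 else b)"
  "mat2 d a b c e (Suc 0, 0) = (if d then 0 else c)" "mat2 d a b c e (Suc 0, Suc 0) = e"
  by (simp_all add: mat2_def)

lemma mat2_eq_iff:
  "mat2 d a b c e = mat2 d a' b' c' e' \<longleftrightarrow> a = a' \<and> e = e' \<and> (d \<or> b = b' \<and> c = c')"
proof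
  assume *: "mat2 d a b c e = mat2 d a' b' c' e'"
  show "a = a' \<and> e = e' \<and> (d \<or> b = b' \<and> c = c')"
    using fun_cong[OF *, of "(0, 0)"] fun_cong[OF *, of "(0, Suc 0)"]
      fun_cong[OF *, of "(Suc 0, 0)"] fun_cong[OF *, of "(Suc 0, Suc 0)"]
    by (auto split: if_splits)
qed (auto simp: mat2_def)

text \<open>Diagonal matrices are literally elements of the full matrix algebra, so the inclusion in
  the first counterexample is \<open>id\<close>.\<close>

lemma mat2_True: "mat2 True a b c e = mat2 False a 0 0 e"
  by (auto simp: mat2_def)

lemma mat2_algebra_simps [simp]:
  "mat2 d a b c e \<in> carrier (mat2_algebra d)"
  "mat2 d a b c e \<otimes>\<^bsub>mat2_algebra d\<^esub> mat2 d a' b' c' e' =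
     mat2 d (a * a' + (if d then 0 else b * c')) (a * b' + b * e') (c * a' + e * c')
       ((if d then 0 else c * b') + e * e')"
  "mat2 d a b c e \<oplus>\<^bsub>mat2_algebra d\<^esub> mat2 d a' b' c' e' = mat2 d (a + a') (b + b') (c + c') (e + e')"
  "t \<odot>\<^bsub>mat2_algebra d\<^esub> mat2 d a b c e = mat2 d (t * a) (t * b) (t * c) (t * e)"
  "star (mat2_algebra d) (mat2 d a b c e) = mat2 d (cnj a) (cnj c) (cnj b) (cnj e)"
  "\<one>\<^bsub>mat2_algebra d\<^esub> = mat2 d 1 0 0 1" "\<zero>\<^bsub>mat2_algebra d\<^esub> = mat2 d 0 0 0 0"
  "nrm (mat2_algebra d) x = onorm (mat2_op x)"
  by (auto simp: mat2_algebra_def mat2_eq_iff)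

lemma mat2_cases:
  assumes "x \<in> carrier (mat2_algebra d)"
  obtains a b c e where "x = mat2 d a b c e"
  using assms by (auto simp: mat2_algebra_def)

lemma star_algebra_mat2: "star_algebra (mat2_algebra d)"
proof -
  let ?A = "mat2_algebra d"
  have group: "abelian_group ?A"
  proof (rule abelian_groupI)
    fix x assume "x \<in> carrier ?A"
    then show "\<exists>y\<in>carrier ?A. y \<oplus>\<^bsub>?A\<^esub> x = \<zero>\<^bsub>?A\<^esub>"
    proof (cases rule: mat2_cases)
      case (1 a b c e)
      then show ?thesis
        by (intro bexI[of _ "mat2 d (- a) (- b) (- c) (- e)"]) simp_all
    qed
  qed (auto elim!: mat2_cases simp: add_ac)
  have "monoid ?A"
    by (rule monoidI) (auto elim!: mat2_cases simp: mat2_eq_iff algebra_simps)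
  then have "ring ?A"
    using group by (intro ringI) (auto elim!: mat2_cases simp: mat2_eq_iff algebra_simps)
  moreover have "Module.module complex_algebra ?A"
    using group cring_complex_algebra
    by (intro moduleI) (auto elim!: mat2_cases simp: mat2_eq_iff algebra_simps)
  ultimately show ?thesis
    by (auto intro!: star_algebra.intro star_algebra_axioms.intro elim!: mat2_cases
        simp: mat2_eq_iff algebra_simps)
qed

text \<open>Stated for arbitrary functions x and y, as the symmetry clause of
  \<open>Metric_space\<close> ranges over the whole type. It holds there because the description of
  the additive inverse looks only at entries of y that the operations retain.\<close>

lemma minus_mat2:
  "x \<ominus>\<^bsub>mat2_algebra d\<^esub> y =
     mat2 d (x (0, 0) - y (0, 0)) (x (0, 1) - y (0, 1)) (x (1, 0) - y (1, 0)) (x (1, 1) - y (1, 1))"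
proof -
  have "\<ominus>\<^bsub>mat2_algebra d\<^esub> y = mat2 d (- y (0, 0)) (- y (0, 1)) (- y (1, 0)) (- y (1, 1))"
    unfolding a_inv_def m_inv_def
  proof (rule the_equality)
    fix z
    assume *: "z \<in> carrier (add_monoid (mat2_algebra d)) \<and>
      y \<otimes>\<^bsub>add_monoid (mat2_algebra d)\<^esub> z = \<one>\<^bsub>add_monoid (mat2_algebra d)\<^esub> \<and>
      z \<otimes>\<^bsub>add_monoid (mat2_algebra d)\<^esub> y = \<one>\<^bsub>add_monoid (mat2_algebra d)\<^esub>"
    then obtain a b c e where z: "z = mat2 d a b c e"
      by (auto elim: mat2_cases)
    have "y (0, 0) + a = 0 \<and> y (1, 1) + e = 0 \<and> (d \<or> y (0, 1) + b = 0 \<and> y (1, 0) + c = 0)"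
      using * unfolding z by (cases d) (simp_all add: mat2_algebra_def mat2_eq_iff)
    then show "z = mat2 d (- y (0, 0)) (- y (0, 1)) (- y (1, 0)) (- y (1, 1))"
      unfolding z mat2_eq_iff by (metis minus_unique)
  qed (simp add: mat2_algebra_def mat2_eq_iff)
  then show ?thesis
    by (auto simp: a_minus_def mat2_algebra_def mat2_eq_iff)
qed

section \<open>The operator norm, the C*-identity and completeness\<close>

lemma bounded_linear_mat2_op: "bounded_linear (mat2_op x)"
  unfolding mat2_op_def
  by (intro bounded_linear_Pair bounded_linear_add
      bounded_linear_compose[OF bounded_linear_mult_right bounded_linear_fst]
      bounded_linear_compose[OF bounded_linear_mult_right bounded_linear_snd])

lemma norm_mat2_op_le: "norm (mat2_op x w) \<le> onorm (mat2_op x) * norm w"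
  by (rule onorm[OF bounded_linear_mat2_op])

lemma mat2_op_mult:
  assumes "x \<in> carrier (mat2_algebra d)" "y \<in> carrier (mat2_algebra d)"
  shows "mat2_op (x \<otimes>\<^bsub>mat2_algebra d\<^esub> y) = mat2_op x \<circ> mat2_op y"
  using assms by (auto elim!: mat2_cases simp: mat2_op_def algebra_simps fun_eq_iff)

text \<open>The inequality \<open>le\<close> is used twice, for t and for its inverse.\<close>

lemma mat2_op_smult:
  assumes "x \<in> carrier (mat2_algebra d)"
  shows "onorm (mat2_op (t \<odot>\<^bsub>mat2_algebra d\<^esub> x)) = cmod t * onorm (mat2_op x)"
proof -
  have eq: "norm (mat2_op (s \<odot>\<^bsub>mat2_algebra d\<^esub> y) w) = cmod s * norm (mat2_op y w)"
    if "y \<in> carrier (mat2_algebra d)" for s y w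
  proof -
    obtain u v where uv: "mat2_op y w = (u, v)"
      by (rule prod.exhaust)
    have "mat2_op (s \<odot>\<^bsub>mat2_algebra d\<^esub> y) w = (s * fst (mat2_op y w), s * snd (mat2_op y w))"
      using that by (auto elim!: mat2_cases simp: mat2_op_def algebra_simps)
    then show ?thesis
      by (simp add: uv norm_Pair norm_mult power_mult_distrib real_sqrt_mult flip: distrib_left)
  qed
  have le: "onorm (mat2_op (s \<odot>\<^bsub>mat2_algebra d\<^esub> y)) \<le> cmod s * onorm (mat2_op y)"
    if "y \<in> carrier (mat2_algebra d)" for s y
    using norm_mat2_op_le[of y]
    by (intro onorm_bound) (auto simp: eq[OF that] mult.assoc onorm_pos_le[OF bounded_linear_mat2_op]
        intro!: mult_left_mono)
  have "cmod t * onorm (mat2_op x) \<le> onorm (mat2_op (t \<odot>\<^bsub>mat2_algebra d\<^esub> x))"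
  proof (cases "t = 0")
    case False
    interpret star_algebra "mat2_algebra d"
      by (rule star_algebra_mat2)
    have "onorm (mat2_op x) \<le> cmod (inverse t) * onorm (mat2_op (t \<odot>\<^bsub>mat2_algebra d\<^esub> x))"
      using le[of "t \<odot>\<^bsub>mat2_algebra d\<^esub> x" "inverse t"] assms False by (simp add: smult_smult)
    then show ?thesis
      using False by (simp add: norm_inverse norm_divide field_simps)
  qed (use onorm_pos_le[OF bounded_linear_mat2_op] in simp)
  then show ?thesis
    using le[OF assms, of t] by simp
qed

lemma inner_mat2_op:
  assumes "x \<in> carrier (mat2_algebra d)"
  shows "inner (mat2_op x v) w = inner v (mat2_op (star (mat2_algebra d) x) w)"
  using assms
  by (auto elim!: mat2_cases simp: mat2_op_def inner_prod_def inner_complex_def algebra_simps)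

text \<open>|y v|^2 = <v, y^* y v> gives N(y)^2 \<le> N(y^* y) \<le> N(y^* ) N(y), with N the
  operator norm. Cancelling N(y) yields N(y) \<le> N(y^* ); applied to x and to its adjoint this is
  an equality.\<close>

lemma cstar_identity_mat2:
  assumes x: "x \<in> carrier (mat2_algebra d)"
  shows "onorm (mat2_op (star (mat2_algebra d) x \<otimes>\<^bsub>mat2_algebra d\<^esub> x)) = (onorm (mat2_op x))\<^sup>2"
proof -
  interpret star_algebra "mat2_algebra d"
    by (rule star_algebra_mat2)
  let ?N = "\<lambda>x. onorm (mat2_op x)" and ?s = "star (mat2_algebra d)"
  have nonneg: "?N y \<ge> 0" for y
    by (rule onorm_pos_le[OF bounded_linear_mat2_op])
  have lower: "(?N y)\<^sup>2 \<le> ?N (?s y \<otimes>\<^bsub>mat2_algebra d\<^esub> y)"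
    and upper: "?N (?s y \<otimes>\<^bsub>mat2_algebra d\<^esub> y) \<le> ?N (?s y) * ?N y"
    if y: "y \<in> carrier (mat2_algebra d)" for y
  proof -
    let ?z = "?s y \<otimes>\<^bsub>mat2_algebra d\<^esub> y"
    have "norm (mat2_op y v) \<le> sqrt (?N ?z) * norm v" for v
    proof (rule power2_le_imp_le)
      have "(norm (mat2_op y v))\<^sup>2 = inner v (mat2_op ?z v)"
        using y by (simp add: power2_norm_eq_inner inner_mat2_op mat2_op_mult)
      also have "\<dots> \<le> norm v * norm (mat2_op ?z v)"
        by (rule norm_cauchy_schwarz)
      also have "\<dots> \<le> norm v * (?N ?z * norm v)"
        by (intro mult_left_mono norm_mat2_op_le) simp
      also have "\<dots> = (sqrt (?N ?z) * norm v)\<^sup>2"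
        using nonneg by (simp add: power_mult_distrib power2_eq_square)
      finally show "(norm (mat2_op y v))\<^sup>2 \<le> (sqrt (?N ?z) * norm v)\<^sup>2" .
    qed (use nonneg in simp)
    then have "?N y \<le> sqrt (?N ?z)"
      using nonneg by (intro onorm_bound) auto
    then have "(?N y)\<^sup>2 \<le> (sqrt (?N ?z))\<^sup>2"
      using nonneg by (intro power_mono) auto
    then show "(?N y)\<^sup>2 \<le> ?N ?z"
      using nonneg by simp
    show "?N ?z \<le> ?N (?s y) * ?N y"
      using y by (simp add: mat2_op_mult onorm_compose[OF bounded_linear_mat2_op bounded_linear_mat2_op])
  qed
  have le: "?N y \<le> ?N (?s y)" if y: "y \<in> carrier (mat2_algebra d)" for y
  proof (cases "?N y = 0")
    case False
    then have "?N y > 0"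
      using nonneg[of y] by simp
    moreover have "?N y * ?N y \<le> ?N (?s y) * ?N y"
      using lower[OF y] upper[OF y] by (simp add: power2_eq_square)
    ultimately show ?thesis
      by simp
  qed (use nonneg in simp)
  have "?N (?s x) = ?N x"
    using le[OF x] le[of "?s x"] x by simp
  then show ?thesis
    using lower[OF x] upper[OF x] by (simp add: power2_eq_square)
qed

text \<open>The columns are the images of the basis vectors. With \<open>onorm_mat2_op_le\<close>
  this makes norm convergence entrywise, which is how completeness is shown.\<close>

lemma cmod_entry_le:
  "cmod (x (0, 0)) \<le> onorm (mat2_op x)" "cmod (x (0, 1)) \<le> onorm (mat2_op x)"
  "cmod (x (1, 0)) \<le> onorm (mat2_op x)" "cmod (x (1, 1)) \<le> onorm (mat2_op x)"
proof -
  have "norm (x (0, 0), x (1, 0)) \<le> onorm (mat2_op x)" "norm (x (0, 1), x (1, 1)) \<le> onorm (mat2_op x)"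
    using norm_mat2_op_le[of x "(1, 0)"] norm_mat2_op_le[of x "(0, 1)"]
    by (simp_all add: mat2_op_def norm_Pair)
  then show "cmod (x (0, 0)) \<le> onorm (mat2_op x)" "cmod (x (0, 1)) \<le> onorm (mat2_op x)"
    "cmod (x (1, 0)) \<le> onorm (mat2_op x)" "cmod (x (1, 1)) \<le> onorm (mat2_op x)"
    by (blast intro: order_trans[OF norm_fst_le] order_trans[OF norm_snd_le])+
qed

lemma onorm_mat2_op_le:
  "onorm (mat2_op x) \<le> cmod (x (0, 0)) + cmod (x (0, 1)) + cmod (x (1, 0)) + cmod (x (1, 1))"
proof (rule onorm_bound)
  fix w :: "complex \<times> complex"
  have fst: "cmod (fst w) \<le> norm w" and snd: "cmod (snd w) \<le> norm w"
    using norm_fst_le[of "fst w" "snd w"] norm_snd_le[of "snd w" "fst w"] by simp_all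
  have "norm (mat2_op x w) \<le> cmod (x (0, 0) * fst w + x (0, 1) * snd w)
      + cmod (x (1, 0) * fst w + x (1, 1) * snd w)"
    unfolding mat2_op_def by (rule norm_Pair_le)
  also have "\<dots> \<le> (cmod (x (0, 0)) * cmod (fst w) + cmod (x (0, 1)) * cmod (snd w))
      + (cmod (x (1, 0)) * cmod (fst w) + cmod (x (1, 1)) * cmod (snd w))"
    unfolding norm_mult[symmetric] by (intro add_mono norm_triangle_ineq)
  also have "\<dots> \<le> (cmod (x (0, 0)) * norm w + cmod (x (0, 1)) * norm w)
      + (cmod (x (1, 0)) * norm w + cmod (x (1, 1)) * norm w)"
    by (intro add_mono mult_left_mono fst snd norm_ge_zero)
  finally show "norm (mat2_op x w) \<le>
      (cmod (x (0, 0)) + cmod (x (0, 1)) + cmod (x (1, 0)) + cmod (x (1, 1))) * norm w"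
    by (simp add: algebra_simps)
qed auto

lemma onorm_mat2_op_eq_0:
  assumes "x \<in> carrier (mat2_algebra d)"
  shows "onorm (mat2_op x) = 0 \<longleftrightarrow> x = \<zero>\<^bsub>mat2_algebra d\<^esub>"
proof
  assume "onorm (mat2_op x) = 0"
  then show "x = \<zero>\<^bsub>mat2_algebra d\<^esub>"
    using cmod_entry_le[of x] assms by (auto elim!: mat2_cases simp: mat2_eq_iff)
next
  assume "x = \<zero>\<^bsub>mat2_algebra d\<^esub>"
  then show "onorm (mat2_op x) = 0"
    using onorm_mat2_op_le[of x] onorm_pos_le[OF bounded_linear_mat2_op, of x] by simp
qed

lemma onorm_mat2_op_add:
  assumes "x \<in> carrier (mat2_algebra d)" "y \<in> carrier (mat2_algebra d)"
  shows "onorm (mat2_op (x \<oplus>\<^bsub>mat2_algebra d\<^esub> y)) \<le> onorm (mat2_op x) + onorm (mat2_op y)"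
proof -
  have "mat2_op (x \<oplus>\<^bsub>mat2_algebra d\<^esub> y) = (\<lambda>w. mat2_op x w + mat2_op y w)"
    using assms by (auto elim!: mat2_cases simp: mat2_op_def fun_eq_iff algebra_simps)
  then show ?thesis
    by (simp add: onorm_triangle[OF bounded_linear_mat2_op bounded_linear_mat2_op])
qed

lemma minus_mat2_closed: "x \<ominus>\<^bsub>mat2_algebra d\<^esub> y \<in> carrier (mat2_algebra d)"
  by (simp add: minus_mat2)

lemma Metric_space_mat2:
  "Metric_space (carrier (mat2_algebra d))
     (\<lambda>x y. nrm (mat2_algebra d) (x \<ominus>\<^bsub>mat2_algebra d\<^esub> y))"
proof
  fix x y z
  show "0 \<le> nrm (mat2_algebra d) (x \<ominus>\<^bsub>mat2_algebra d\<^esub> y)"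
    by (simp add: onorm_pos_le[OF bounded_linear_mat2_op])
  have "x \<ominus>\<^bsub>mat2_algebra d\<^esub> y = (-1) \<odot>\<^bsub>mat2_algebra d\<^esub> (y \<ominus>\<^bsub>mat2_algebra d\<^esub> x)"
    by (simp add: minus_mat2)
  then show "nrm (mat2_algebra d) (x \<ominus>\<^bsub>mat2_algebra d\<^esub> y) =
      nrm (mat2_algebra d) (y \<ominus>\<^bsub>mat2_algebra d\<^esub> x)"
    using mat2_op_smult[where t = "-1" and d = d, OF minus_mat2_closed, of y x] by simp
  show "nrm (mat2_algebra d) (x \<ominus>\<^bsub>mat2_algebra d\<^esub> y) = 0 \<longleftrightarrow> x = y"
    if "x \<in> carrier (mat2_algebra d)" "y \<in> carrier (mat2_algebra d)"
    using that onorm_mat2_op_eq_0[OF minus_mat2_closed, of d x y]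
    by (auto elim!: mat2_cases simp: minus_mat2 mat2_eq_iff)
  have "x \<ominus>\<^bsub>mat2_algebra d\<^esub> z = (x \<ominus>\<^bsub>mat2_algebra d\<^esub> y) \<oplus>\<^bsub>mat2_algebra d\<^esub> (y \<ominus>\<^bsub>mat2_algebra d\<^esub> z)"
    by (simp add: minus_mat2)
  then show "nrm (mat2_algebra d) (x \<ominus>\<^bsub>mat2_algebra d\<^esub> z) \<le>
      nrm (mat2_algebra d) (x \<ominus>\<^bsub>mat2_algebra d\<^esub> y) + nrm (mat2_algebra d) (y \<ominus>\<^bsub>mat2_algebra d\<^esub> z)"
    using onorm_mat2_op_add[OF minus_mat2_closed minus_mat2_closed, of d x y y z] by simp
qed

lemma mcomplete_mat2:
  "Metric_space.mcomplete (carrier (mat2_algebra d))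
     (\<lambda>x y. nrm (mat2_algebra d) (x \<ominus>\<^bsub>mat2_algebra d\<^esub> y))"
proof -
  interpret Metric_space "carrier (mat2_algebra d)"
    "\<lambda>x y. nrm (mat2_algebra d) (x \<ominus>\<^bsub>mat2_algebra d\<^esub> y)"
    by (rule Metric_space_mat2)
  show ?thesis
    unfolding mcomplete_def
  proof (intro allI impI)
    fix \<sigma> assume \<sigma>: "MCauchy \<sigma>"
    then have carrier: "\<sigma> n \<in> carrier (mat2_algebra d)" for n
      unfolding MCauchy_def by blast
    have entries: "(\<sigma> n \<ominus>\<^bsub>mat2_algebra d\<^esub> \<sigma> m) p = \<sigma> n p - \<sigma> m p" for n m p
      using carrier[of n] carrier[of m] by (auto elim!: mat2_cases simp: minus_mat2) (simp_all add: mat2_def)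
    have "Cauchy (\<lambda>n. \<sigma> n p)" if p: "p \<in> {(0, 0), (0, 1), (1, 0), (1, 1)}" for p
      unfolding Cauchy_def dist_norm
    proof (intro allI impI)
      fix \<epsilon> :: real assume "\<epsilon> > 0"
      then obtain N where N: "\<And>n m. N \<le> n \<Longrightarrow> N \<le> m \<Longrightarrow>
          nrm (mat2_algebra d) (\<sigma> n \<ominus>\<^bsub>mat2_algebra d\<^esub> \<sigma> m) < \<epsilon>"
        using \<sigma> unfolding MCauchy_def by blast
      have "cmod (\<sigma> n p - \<sigma> m p) < \<epsilon>" if "N \<le> n" "N \<le> m" for n m
        using N[OF that] cmod_entry_le[of "\<sigma> n \<ominus>\<^bsub>mat2_algebra d\<^esub> \<sigma> m"] p
        by (auto simp: entries)
      then show "\<exists>N. \<forall>m\<ge>N. \<forall>n\<ge>N. cmod (\<sigma> m p - \<sigma> n p) < \<epsilon>"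
        by blast
    qed
    then have conv: "\<exists>L. (\<lambda>n. \<sigma> n p) \<longlonglongrightarrow> L" if "p \<in> {(0, 0), (0, 1), (1, 0), (1, 1)}" for p
      using that unfolding convergent_def[symmetric] by (blast intro: Cauchy_convergent)
    obtain a b c e where lim: "(\<lambda>n. \<sigma> n (0, 0)) \<longlonglongrightarrow> a" "(\<lambda>n. \<sigma> n (0, 1)) \<longlonglongrightarrow> b"
      "(\<lambda>n. \<sigma> n (1, 0)) \<longlonglongrightarrow> c" "(\<lambda>n. \<sigma> n (1, 1)) \<longlonglongrightarrow> e"
      using conv[of "(0, 0)"] conv[of "(0, 1)"] conv[of "(1, 0)"] conv[of "(1, 1)"] by auto
    define l where "l = mat2 d a b c e"
    define D where "D n = cmod (\<sigma> n (0, 0) - a) + cmod (\<sigma> n (0, 1) - b) + cmod (\<sigma> n (1, 0) - c)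
      + cmod (\<sigma> n (1, 1) - e)" for n
    have "D \<longlonglongrightarrow> cmod (a - a) + cmod (b - b) + cmod (c - c) + cmod (e - e)"
      unfolding D_def by (intro tendsto_intros lim)
    then have D: "D \<longlonglongrightarrow> 0"
      by simp
    have le: "nrm (mat2_algebra d) (\<sigma> n \<ominus>\<^bsub>mat2_algebra d\<^esub> l) \<le> D n" for n
      unfolding mat2_algebra_simps(8) D_def
      by (rule order_trans[OF onorm_mat2_op_le], intro add_mono) (simp_all add: minus_mat2 l_def)
    have "limitin mtopology \<sigma> l sequentially"
      unfolding limitin_metric
    proof (intro conjI allI impI)
      show "l \<in> carrier (mat2_algebra d)"
        by (simp add: l_def)
      fix \<epsilon> :: real assume "\<epsilon> > 0"
      then have "\<forall>\<^sub>F n in sequentially. D n < \<epsilon>"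
        using order_tendstoD(2)[OF D] by blast
      then show "\<forall>\<^sub>F n in sequentially. \<sigma> n \<in> carrier (mat2_algebra d) \<and>
          nrm (mat2_algebra d) (\<sigma> n \<ominus>\<^bsub>mat2_algebra d\<^esub> l) < \<epsilon>"
        by (rule eventually_mono) (use carrier le in \<open>auto intro: le_less_trans\<close>)
    qed
    then show "\<exists>l. limitin mtopology \<sigma> l sequentially"
      by blast
  qed
qed

lemma (in abelian_monoid) finsum_doubleton:
  assumes "f \<in> {i, j} \<rightarrow> carrier G" "i \<noteq> j"
  shows "(\<Oplus>k\<in>{i, j}. f k) = f i \<oplus> f j"
  using assms by (simp add: finsum_insert Pi_iff)

lemma (in abelian_monoid) finsum_four:
  assumes "f \<in> {i, j, k, l} \<rightarrow> carrier G" "distinct [i, j, k, l]"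
  shows "(\<Oplus>m\<in>{i, j, k, l}. f m) = f i \<oplus> (f j \<oplus> (f k \<oplus> f l))"
  using assms by (simp add: finsum_insert Pi_iff)

lemma finite_dim_mat2:
  "\<exists>S. finite S \<and> S \<subseteq> carrier (mat2_algebra d) \<and>
    (\<forall>x\<in>carrier (mat2_algebra d). \<exists>f. x = (\<Oplus>\<^bsub>mat2_algebra d\<^esub>s\<in>S. f s \<odot>\<^bsub>mat2_algebra d\<^esub> s))"
proof -
  interpret star_algebra "mat2_algebra d"
    by (rule star_algebra_mat2)
  let ?E = "mat2 d 1 0 0 0" and ?E' = "mat2 d 0 0 0 1"
    and ?O = "mat2 d 0 1 0 0" and ?O' = "mat2 d 0 0 1 0"
  \<comment> \<open>On a matrix unit s this picks out the corresponding entry of x.\<close>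
  define f where "f x s = x (0, 0) * s (0, 0) + x (0, 1) * s (0, 1) + x (1, 0) * s (1, 0)
      + x (1, 1) * s (1, 1)" for x s :: "nat \<times> nat \<Rightarrow> complex"
  show ?thesis
  proof (cases d)
    case True
    have "x = (\<Oplus>\<^bsub>mat2_algebra d\<^esub>s\<in>{?E, ?E'}. f x s \<odot>\<^bsub>mat2_algebra d\<^esub> s)"
      if "x \<in> carrier (mat2_algebra d)" for x
      using that True by (subst finsum_doubleton)
        (auto elim!: mat2_cases simp: mat2_eq_iff f_def)
    then have "\<forall>x\<in>carrier (mat2_algebra d).
        \<exists>f. x = (\<Oplus>\<^bsub>mat2_algebra d\<^esub>s\<in>{?E, ?E'}. f s \<odot>\<^bsub>mat2_algebra d\<^esub> s)"
      by blast
    then show ?thesis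
      by (intro exI[of _ "{?E, ?E'}"]) simp
  next
    case False
    have "x = (\<Oplus>\<^bsub>mat2_algebra d\<^esub>s\<in>{?E, ?O, ?O', ?E'}. f x s \<odot>\<^bsub>mat2_algebra d\<^esub> s)"
      if "x \<in> carrier (mat2_algebra d)" for x
      using that False by (subst finsum_four)
        (auto elim!: mat2_cases simp: mat2_eq_iff f_def)
    then have "\<forall>x\<in>carrier (mat2_algebra d).
        \<exists>f. x = (\<Oplus>\<^bsub>mat2_algebra d\<^esub>s\<in>{?E, ?O, ?O', ?E'}. f s \<odot>\<^bsub>mat2_algebra d\<^esub> s)"
      by blast
    then show ?thesis
      by (intro exI[of _ "{?E, ?O, ?O', ?E'}"]) simp
  qed
qed

lemma fd_cstar_algebra_mat2: "fd_cstar_algebra (mat2_algebra d)"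
proof -
  interpret star_algebra "mat2_algebra d"
    by (rule star_algebra_mat2)
  have "nrm (mat2_algebra d) (x \<otimes>\<^bsub>mat2_algebra d\<^esub> y) \<le> nrm (mat2_algebra d) x * nrm (mat2_algebra d) y"
    if "x \<in> carrier (mat2_algebra d)" "y \<in> carrier (mat2_algebra d)" for x y
    using onorm_compose[OF bounded_linear_mat2_op bounded_linear_mat2_op] mat2_op_mult[OF that] by simp
  then have "cstar_algebra_axioms (mat2_algebra d)"
    using onorm_pos_le[OF bounded_linear_mat2_op] mcomplete_mat2[of d]
    by (intro cstar_algebra_axioms.intro)
      (simp_all only: mat2_algebra_simps(8) onorm_mat2_op_eq_0 onorm_mat2_op_add mat2_op_smult
        cstar_identity_mat2)
  then show ?thesis
    using finite_dim_mat2 star_algebra_axioms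
    by (intro fd_cstar_algebra.intro fd_cstar_algebra_axioms.intro cstar_algebra.intro)
qed

section \<open>Counterexamples\<close>

lemma cring_mat2_iff: "cring (mat2_algebra d) \<longleftrightarrow> d"
proof
  assume "cring (mat2_algebra d)"
  then interpret cring "mat2_algebra d" .
  show d
    using m_comm[of "mat2 d 0 1 0 0" "mat2 d 0 0 1 0"] by (simp add: mat2_eq_iff split: if_splits)
next
  interpret star_algebra "mat2_algebra d"
    by (rule star_algebra_mat2)
  assume d
  then have "comm_monoid (mat2_algebra d)"
    by (intro monoid_comm_monoidI) (auto elim!: mat2_cases simp: mat2_eq_iff)
  with ring_axioms show "cring (mat2_algebra d)"
    by (rule cring.intro)
qed

text \<open>Applying F entrywise to a factor of a positive matrix gives a factor of the
  image.\<close>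

lemma cpu_map_star_hom:
  assumes "star_algebra B" "star_algebra A" and F: "linear_map B A F" "F \<one>\<^bsub>B\<^esub> = \<one>\<^bsub>A\<^esub>"
    and mult: "\<And>x y. x \<in> carrier B \<Longrightarrow> y \<in> carrier B \<Longrightarrow> F (x \<otimes>\<^bsub>B\<^esub> y) = F x \<otimes>\<^bsub>A\<^esub> F y"
    and star: "\<And>x. x \<in> carrier B \<Longrightarrow> F (star B x) = star A (F x)"
  shows "cpu_map B A F"
proof -
  interpret A: star_algebra A by fact
  interpret B: star_algebra B by fact
  note closed [simp] = linear_map_closed[OF F(1)]
  have "positive_map (mat_algebra n B) (mat_algebra n A) (amplify n F)" for n
    unfolding positive_map_def
  proof (intro conjI allI impI)
    show "linear_map (mat_algebra n B) (mat_algebra n A) (amplify n F)"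
      using F(1) by (rule linear_map_amplify)
  next
    fix x assume "positive (mat_algebra n B) x"
    let ?I = "{..<n} \<times> {..<n}"
    obtain y where y: "y \<in> ?I \<rightarrow>\<^sub>E carrier B"
      and x: "x = (\<lambda>(i, j)\<in>?I. \<Oplus>\<^bsub>B\<^esub>k\<in>{..<n}. star B (y (k, i)) \<otimes>\<^bsub>B\<^esub> y (k, j))"
      using \<open>positive (mat_algebra n B) x\<close> by (auto simp: B.positive_mat_algebra_iff)
    have yc: "y (k, i) \<in> carrier B" if "k < n" "i < n" for k i
      using PiE_mem[OF y] that by auto
    have "amplify n F x =
        (\<lambda>(i, j)\<in>?I. \<Oplus>\<^bsub>A\<^esub>k\<in>{..<n}. star A (amplify n F y (k, i)) \<otimes>\<^bsub>A\<^esub> amplify n F y (k, j))"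
      unfolding amplify_def
    proof (intro restrict_ext, clarify)
      fix i j assume ij: "i < n" "j < n"
      have "F (x (i, j)) = (\<Oplus>\<^bsub>A\<^esub>k\<in>{..<n}. F (star B (y (k, i)) \<otimes>\<^bsub>B\<^esub> y (k, j)))"
        using ij yc by (simp add: x linear_map_finsum[OF assms(1-3)] Pi_def)
      also have "\<dots> = (\<Oplus>\<^bsub>A\<^esub>k\<in>{..<n}. star A (restrict (\<lambda>p. F (y p)) ?I (k, i)) \<otimes>\<^bsub>A\<^esub>
          restrict (\<lambda>p. F (y p)) ?I (k, j))"
        using ij yc by (intro A.finsum_cong') (auto simp: mult star)
      finally show "F (x (i, j)) = (\<Oplus>\<^bsub>A\<^esub>k\<in>{..<n}. star A (restrict (\<lambda>p. F (y p)) ?I (k, i)) \<otimes>\<^bsub>A\<^esub>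
          restrict (\<lambda>p. F (y p)) ?I (k, j))" .
    qed
    moreover have "amplify n F y \<in> ?I \<rightarrow>\<^sub>E carrier A"
      using yc by (auto simp: amplify_def)
    ultimately show "positive (mat_algebra n A) (amplify n F x)"
      unfolding A.positive_mat_algebra_iff by blast
  qed
  then show ?thesis
    using F by (simp add: cpu_map_def)
qed

lemma nonneg_Reals_cnj_mult [simp]: "cnj z * z \<in> \<real>\<^sub>\<ge>\<^sub>0"
  by (simp add: complex_nonneg_Reals_iff)

section \<open>The states and maps of the two counterexamples\<close>

definition corner_state :: "(nat \<times> nat \<Rightarrow> complex) \<Rightarrow> complex" where
  "corner_state x = x (0, 0)"

text \<open>The vector state of (1, 1) / sqrt 2.\<close>

definition plus_state :: "(nat \<times> nat \<Rightarrow> complex) \<Rightarrow> complex" where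
  "plus_state x = (x (0, 0) + x (0, 1) + x (1, 0) + x (1, 1)) / 2"

definition trace_state :: "(nat \<times> nat \<Rightarrow> complex) \<Rightarrow> complex" where
  "trace_state x = (x (0, 0) + x (1, 1)) / 2"

lemma state_mat2I:
  assumes "\<And>x y. x \<in> carrier (mat2_algebra d) \<Longrightarrow> y \<in> carrier (mat2_algebra d) \<Longrightarrow>
      \<phi> (x \<oplus>\<^bsub>mat2_algebra d\<^esub> y) = \<phi> x + \<phi> y"
    and "\<And>c x. x \<in> carrier (mat2_algebra d) \<Longrightarrow> \<phi> (c \<odot>\<^bsub>mat2_algebra d\<^esub> x) = c * \<phi> x"
    and "\<And>x. x \<in> carrier (mat2_algebra d) \<Longrightarrow>
      \<phi> (star (mat2_algebra d) x \<otimes>\<^bsub>mat2_algebra d\<^esub> x) \<in> \<real>\<^sub>\<ge>\<^sub>0"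
    and "\<phi> \<one>\<^bsub>mat2_algebra d\<^esub> = 1"
  shows "state (mat2_algebra d) \<phi>"
  using assms by (auto simp: state_iff positive_functional_def linear_functional_def linear_map_def)

lemma state_corner: "state (mat2_algebra d) corner_state"
  by (rule state_mat2I) (auto elim!: mat2_cases simp: corner_state_def)

lemma state_trace: "state (mat2_algebra d) trace_state"
  by (rule state_mat2I)
    (auto elim!: mat2_cases simp: trace_state_def field_simps complex_nonneg_Reals_iff)

lemma state_plus: "state (mat2_algebra False) plus_state"
proof (rule state_mat2I)
  fix x assume "x \<in> carrier (mat2_algebra False)"
  then obtain a b c e where x: "x = mat2 False a b c e"
    by (rule mat2_cases)
  \<comment> \<open>a + b and c + e are the entries of x applied to (1, 1).\<close>
  have "plus_state (star (mat2_algebra False) x \<otimes>\<^bsub>mat2_algebra False\<^esub> x) =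
      (cnj (a + b) * (a + b) + cnj (c + e) * (c + e)) / 2"
    by (simp add: x plus_state_def algebra_simps add_divide_distrib)
  also have "\<dots> \<in> \<real>\<^sub>\<ge>\<^sub>0"
    by (intro nonneg_Reals_divide_I nonneg_Reals_add_I nonneg_Reals_cnj_mult) simp
  finally show "plus_state (star (mat2_algebra False) x \<otimes>\<^bsub>mat2_algebra False\<^esub> x) \<in> \<real>\<^sub>\<ge>\<^sub>0" .
qed (auto elim!: mat2_cases simp: plus_state_def field_simps)

lemma bayes_data_inclusion: "bayes_data (mat2_algebra True) (mat2_algebra False) id plus_state"
proof -
  have "cpu_map (mat2_algebra True) (mat2_algebra False) id"
  proof (rule cpu_map_star_hom[OF star_algebra_mat2 star_algebra_mat2])
    show "linear_map (mat2_algebra True) (mat2_algebra False) id"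
      by (auto simp: linear_map_def mat2_algebra_def mat2_True mat2_eq_iff)
  qed (auto simp: mat2_algebra_def mat2_True mat2_eq_iff)
  then show ?thesis
    by (simp add: bayes_data_def fd_cstar_algebra_mat2 state_plus)
qed

lemma inclusion_ae_deterministic:
  "ae_deterministic (mat2_algebra True) (mat2_algebra False) id plus_state"
  by (auto simp: ae_deterministic_def plus_state_def mat2_algebra_def mat2_True algebra_simps)

text \<open>Testing against E_00 fixes the corner entry of G(a) as 2 \<omega>(a E_00). This is 0 for
  a = E_01 and 1 for a = E_10, although these two are adjoint to each other.\<close>

lemma inclusion_no_bayesian_inverse:
  "\<not> cpu_bayesian_inverse (mat2_algebra True) (mat2_algebra False) id plus_state (plus_state \<circ> id) G"
proof
  let ?A = "mat2_algebra False" and ?B = "mat2_algebra True"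
  assume *: "cpu_bayesian_inverse ?B ?A id plus_state (plus_state \<circ> id) G"
  interpret cpu ?B ?A G
    using * star_algebra_mat2 by (auto simp: cpu_def cpu_axioms_def cpu_bayesian_inverse_def)
  have bayes: "plus_state (G a \<otimes>\<^bsub>?B\<^esub> b) = plus_state (a \<otimes>\<^bsub>?A\<^esub> b)"
    if "a \<in> carrier ?A" "b \<in> carrier ?B" for a b
    using * that by (simp add: cpu_bayesian_inverse_def)
  let ?x = "mat2 False 0 1 0 0"
  have "G ?x \<in> carrier ?B"
    by simp
  then obtain p q r s where g: "G ?x = mat2 True p q r s"
    by (rule mat2_cases)
  have "G (mat2 False 0 0 1 0) = star ?B (G ?x)"
    using star_preserving[of ?x] by simp
  then have g': "G (mat2 False 0 0 1 0) = mat2 True (cnj p) (cnj r) (cnj q) (cnj s)"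
    by (simp add: g)
  have "p = 0"
    using bayes[OF mat2_algebra_simps(1) mat2_algebra_simps(1), of 0 1 0 0 1 0 0 0]
    by (simp add: g mat2_algebra_def plus_state_def)
  moreover have "cnj p = 1"
    using bayes[OF mat2_algebra_simps(1) mat2_algebra_simps(1), of 0 0 1 0 1 0 0 0]
    by (simp add: g' mat2_algebra_def plus_state_def)
  ultimately show False
    by simp
qed

text \<open>The flag d places the same map into the diagonal or the full matrix algebra, so one
  computation serves commutative and noncommutative A.\<close>

definition two_states_map :: "bool \<Rightarrow> (nat \<times> nat \<Rightarrow> complex) \<Rightarrow> nat \<times> nat \<Rightarrow> complex" where
  "two_states_map d b = mat2 d (corner_state b) 0 0 (plus_state b)"

lemma bayes_data_two_states:
  "bayes_data (mat2_algebra False) (mat2_algebra d) (two_states_map d) trace_state"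
proof -
  let ?q = "\<lambda>j::bool. if j then mat2 d 1 0 0 0 else mat2 d 0 0 0 1"
  interpret star_algebra "mat2_algebra d"
    by (rule star_algebra_mat2)
  interpret orthogonal_resolution "mat2_algebra d" UNIV ?q
    by unfold_locales (auto simp: UNIV_bool mat2_eq_iff finsum_doubleton split: if_splits)
  have "diagonal c = mat2 d (c True) 0 0 (c False)" for c
    unfolding diagonal_def unfolding UNIV_bool by (simp add: finsum_doubleton)
  then have "cpu_map (mat2_algebra False) (mat2_algebra d) (two_states_map d)"
    using cpu_map_diagonal[where A = "mat2_algebra False" and
        \<phi> = "\<lambda>j. if j then corner_state else plus_state", OF star_algebra_mat2]
    by (simp add: state_corner state_plus two_states_map_def[abs_def])
  then show ?thesis
    by (simp add: bayes_data_def fd_cstar_algebra_mat2 state_trace)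
qed

text \<open>E_00 is idempotent, but its image diag (1, 1/2) is not: the normalized traces are 5/8
  for the square and 3/4 for the image itself.\<close>

lemma two_states_not_ae_deterministic:
  "\<not> ae_deterministic (mat2_algebra False) (mat2_algebra d) (two_states_map d) trace_state"
proof
  let ?e = "mat2 False 1 0 0 0" and ?A = "mat2_algebra d" and ?B = "mat2_algebra False"
  assume "ae_deterministic ?B ?A (two_states_map d) trace_state"
  then have "trace_state (\<one>\<^bsub>?A\<^esub> \<otimes>\<^bsub>?A\<^esub> two_states_map d ?e \<otimes>\<^bsub>?A\<^esub> two_states_map d ?e) =
      trace_state (\<one>\<^bsub>?A\<^esub> \<otimes>\<^bsub>?A\<^esub> two_states_map d (?e \<otimes>\<^bsub>?B\<^esub> ?e))"
    unfolding ae_deterministic_def by (metis mat2_algebra_simps(1,6))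
  then show False
    by (simp add: two_states_map_def trace_state_def corner_state_def plus_state_def)
qed

text \<open>Let P_1, P_2 be the rank one projections of the two vector states and \<rho> = (P_1 +
  P_2) / 2 the density of \<xi>. For x = E_00 the Bayes condition says \<rho> G(x) = P_1 / 2, and
  \<rho> is invertible. The solution has rows (1, 0) and (-1, 0), which is not self-adjoint, while x
  is.\<close>

lemma two_states_no_bayesian_inverse:
  "\<not> cpu_bayesian_inverse (mat2_algebra False) (mat2_algebra d) (two_states_map d) trace_state
     (trace_state \<circ> two_states_map d) G"
proof
  let ?A = "mat2_algebra d" and ?B = "mat2_algebra False" and ?F = "two_states_map d"
  assume *: "cpu_bayesian_inverse ?B ?A ?F trace_state (trace_state \<circ> ?F) G"
  interpret cpu ?B ?A G
    using * star_algebra_mat2 by (auto simp: cpu_def cpu_axioms_def cpu_bayesian_inverse_def)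
  have bayes: "trace_state (?F (G a \<otimes>\<^bsub>?B\<^esub> b)) = trace_state (a \<otimes>\<^bsub>?A\<^esub> ?F b)"
    if "a \<in> carrier ?A" "b \<in> carrier ?B" for a b
    using * that by (simp add: cpu_bayesian_inverse_def)
  let ?x = "mat2 d 1 0 0 0"
  have "G ?x \<in> carrier ?B"
    by simp
  then obtain p q r s where g: "G ?x = mat2 False p q r s"
    by (rule mat2_cases)
  note simps = g two_states_map_def trace_state_def corner_state_def plus_state_def
  \<comment> \<open>Testing against the four matrix units gives the equations for the entries of
    G(x), two for each column.\<close>
  have "(p + (p + r) / 2) / 2 = 1 / 2"
    using bayes[of ?x "mat2 False 1 0 0 0"] by (simp add: simps)
  moreover have "p + r = 0"
    using bayes[of ?x "mat2 False 0 1 0 0"] by (simp add: simps)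
  ultimately have "p = 1"
    by simp
  have "r = - p"
    using \<open>p + r = 0\<close> by (rule minus_unique[symmetric])
  have "q + s = 0"
    using bayes[of ?x "mat2 False 0 0 0 1"] by (simp add: simps)
  moreover have "(q + (q + s) / 2) / 2 = 0"
    using bayes[of ?x "mat2 False 0 0 1 0"] by (simp add: simps)
  ultimately have "q = 0"
    by simp
  moreover have "G (star ?A ?x) = star ?B (G ?x)"
    by (rule star_preserving) simp
  then have "mat2 False p q r s = mat2 False (cnj p) (cnj r) (cnj q) (cnj s)"
    by (simp only: mat2_algebra_simps complex_cnj_one complex_cnj_zero g)
  then have "q = cnj r"
    unfolding mat2_eq_iff by blast
  ultimately show False
    using \<open>p = 1\<close> \<open>r = - p\<close> by simp
qed

text \<open>"Need not exist" is given its strong reading: one example for each combination in which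
  some hypothesis fails, three for disintegrations and three for Bayesian inverses.\<close>

theorem corollary8p42:
  shows "(\<forall>(B :: 'b cstar_algebra) (A :: 'a cstar_algebra) F \<omega>. bayes_data B A F \<omega> \<longrightarrow>
      (let \<xi> = \<omega> \<circ> F in
        (\<forall>G G'. cpu_bayesian_inverse B A F \<omega> \<xi> G \<and> cpu_bayesian_inverse B A F \<omega> \<xi> G' \<longrightarrow>
           ae_equiv A B \<xi> G G') \<and>
        (\<forall>G. cpu_bayesian_inverse B A F \<omega> \<xi> G \<longrightarrow>
           (ae_deterministic B A F \<omega> \<longleftrightarrow> cpu_disintegration B A F \<omega> \<xi> G)) \<and>
        (\<forall>G. cpu_disintegration B A F \<omega> \<xi> G \<longrightarrow>
           ae_deterministic B A F \<omega> \<and> cpu_bayesian_inverse B A F \<omega> \<xi> G) \<and>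
        (ae_deterministic B A F \<omega> \<longrightarrow>
           ((\<exists>G. cpu_bayesian_inverse B A F \<omega> \<xi> G) \<longleftrightarrow> (\<exists>G. cpu_disintegration B A F \<omega> \<xi> G))) \<and>
        (\<forall>G G'. cpu_disintegration B A F \<omega> \<xi> G \<and> cpu_disintegration B A F \<omega> \<xi> G' \<longrightarrow>
           ae_equiv A B \<xi> G G') \<and>
        (cring A \<and> ae_deterministic B A F \<omega> \<longrightarrow> (\<exists>G. cpu_disintegration B A F \<omega> \<xi> G)) \<and>
        (cring A \<and> cring B \<longrightarrow> (\<exists>G. cpu_bayesian_inverse B A F \<omega> \<xi> G)))) \<and>
    (\<exists>(B :: matrix_algebra) (A :: matrix_algebra) F \<omega>. bayes_data B A F \<omega> \<and>
       \<not> cring A \<and> ae_deterministic B A F \<omega> \<and> (\<nexists>G. cpu_disintegration B A F \<omega> (\<omega> \<circ> F) G)) \<and>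
    (\<exists>(B :: matrix_algebra) (A :: matrix_algebra) F \<omega>. bayes_data B A F \<omega> \<and>
       cring A \<and> \<not> ae_deterministic B A F \<omega> \<and> (\<nexists>G. cpu_disintegration B A F \<omega> (\<omega> \<circ> F) G)) \<and>
    (\<exists>(B :: matrix_algebra) (A :: matrix_algebra) F \<omega>. bayes_data B A F \<omega> \<and>
       \<not> cring A \<and> \<not> ae_deterministic B A F \<omega> \<and> (\<nexists>G. cpu_disintegration B A F \<omega> (\<omega> \<circ> F) G)) \<and>
    (\<exists>(B :: matrix_algebra) (A :: matrix_algebra) F \<omega>. bayes_data B A F \<omega> \<and>
       \<not> cring A \<and> cring B \<and> (\<nexists>G. cpu_bayesian_inverse B A F \<omega> (\<omega> \<circ> F) G)) \<and>
    (\<exists>(B :: matrix_algebra) (A :: matrix_algebra) F \<omega>. bayes_data B A F \<omega> \<and>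
       cring A \<and> \<not> cring B \<and> (\<nexists>G. cpu_bayesian_inverse B A F \<omega> (\<omega> \<circ> F) G)) \<and>
    (\<exists>(B :: matrix_algebra) (A :: matrix_algebra) F \<omega>. bayes_data B A F \<omega> \<and>
       \<not> cring A \<and> \<not> cring B \<and> (\<nexists>G. cpu_bayesian_inverse B A F \<omega> (\<omega> \<circ> F) G))"
proof (intro conjI)
  show "\<forall>(B :: 'b cstar_algebra) (A :: 'a cstar_algebra) F \<omega>. bayes_data B A F \<omega> \<longrightarrow>
      (let \<xi> = \<omega> \<circ> F in
        (\<forall>G G'. cpu_bayesian_inverse B A F \<omega> \<xi> G \<and> cpu_bayesian_inverse B A F \<omega> \<xi> G' \<longrightarrow>
           ae_equiv A B \<xi> G G') \<and>
        (\<forall>G. cpu_bayesian_inverse B A F \<omega> \<xi> G \<longrightarrow>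
           (ae_deterministic B A F \<omega> \<longleftrightarrow> cpu_disintegration B A F \<omega> \<xi> G)) \<and>
        (\<forall>G. cpu_disintegration B A F \<omega> \<xi> G \<longrightarrow>
           ae_deterministic B A F \<omega> \<and> cpu_bayesian_inverse B A F \<omega> \<xi> G) \<and>
        (ae_deterministic B A F \<omega> \<longrightarrow>
           ((\<exists>G. cpu_bayesian_inverse B A F \<omega> \<xi> G) \<longleftrightarrow> (\<exists>G. cpu_disintegration B A F \<omega> \<xi> G))) \<and>
        (\<forall>G G'. cpu_disintegration B A F \<omega> \<xi> G \<and> cpu_disintegration B A F \<omega> \<xi> G' \<longrightarrow>
           ae_equiv A B \<xi> G G') \<and>
        (cring A \<and> ae_deterministic B A F \<omega> \<longrightarrow> (\<exists>G. cpu_disintegration B A F \<omega> \<xi> G)) \<and>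
        (cring A \<and> cring B \<longrightarrow> (\<exists>G. cpu_bayesian_inverse B A F \<omega> \<xi> G)))"
    unfolding Let_def
  proof (intro allI impI)
    fix B :: "'b cstar_algebra" and A :: "'a cstar_algebra" and F \<omega>
    assume "bayes_data B A F \<omega>"
    note part = bayes_data_consequences[OF this refl]
    show "(\<forall>G G'. cpu_bayesian_inverse B A F \<omega> (\<omega> \<circ> F) G \<and> cpu_bayesian_inverse B A F \<omega> (\<omega> \<circ> F) G' \<longrightarrow>
           ae_equiv A B (\<omega> \<circ> F) G G') \<and>
        (\<forall>G. cpu_bayesian_inverse B A F \<omega> (\<omega> \<circ> F) G \<longrightarrow>
           (ae_deterministic B A F \<omega> \<longleftrightarrow> cpu_disintegration B A F \<omega> (\<omega> \<circ> F) G)) \<and>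
        (\<forall>G. cpu_disintegration B A F \<omega> (\<omega> \<circ> F) G \<longrightarrow>
           ae_deterministic B A F \<omega> \<and> cpu_bayesian_inverse B A F \<omega> (\<omega> \<circ> F) G) \<and>
        (ae_deterministic B A F \<omega> \<longrightarrow>
           ((\<exists>G. cpu_bayesian_inverse B A F \<omega> (\<omega> \<circ> F) G) \<longleftrightarrow> (\<exists>G. cpu_disintegration B A F \<omega> (\<omega> \<circ> F) G))) \<and>
        (\<forall>G G'. cpu_disintegration B A F \<omega> (\<omega> \<circ> F) G \<and> cpu_disintegration B A F \<omega> (\<omega> \<circ> F) G' \<longrightarrow>
           ae_equiv A B (\<omega> \<circ> F) G G') \<and>
        (cring A \<and> ae_deterministic B A F \<omega> \<longrightarrow> (\<exists>G. cpu_disintegration B A F \<omega> (\<omega> \<circ> F) G)) \<and>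
        (cring A \<and> cring B \<longrightarrow> (\<exists>G. cpu_bayesian_inverse B A F \<omega> (\<omega> \<circ> F) G))"
      using part by blast
  qed
next
  \<comment> \<open>A disintegration would be a Bayesian inverse, so the absence of the latter
    excludes both.\<close>
  note inclusion = bayes_data_inclusion inclusion_ae_deterministic inclusion_no_bayesian_inverse
    bayes_data_consequences(4)[OF bayes_data_inclusion refl]
  show "\<exists>(B :: matrix_algebra) (A :: matrix_algebra) F \<omega>. bayes_data B A F \<omega> \<and>
      \<not> cring A \<and> ae_deterministic B A F \<omega> \<and> (\<nexists>G. cpu_disintegration B A F \<omega> (\<omega> \<circ> F) G)"
    using inclusion cring_mat2_iff by blast
  show "\<exists>(B :: matrix_algebra) (A :: matrix_algebra) F \<omega>. bayes_data B A F \<omega> \<and>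
      \<not> cring A \<and> cring B \<and> (\<nexists>G. cpu_bayesian_inverse B A F \<omega> (\<omega> \<circ> F) G)"
    using inclusion cring_mat2_iff by blast
next
  \<comment> \<open>Here disintegrations are excluded because they would make the map a.e.
    deterministic.\<close>
  note two_states = bayes_data_two_states two_states_not_ae_deterministic
    two_states_no_bayesian_inverse bayes_data_consequences(3)[OF bayes_data_two_states refl]
  show "\<exists>(B :: matrix_algebra) (A :: matrix_algebra) F \<omega>. bayes_data B A F \<omega> \<and>
      cring A \<and> \<not> ae_deterministic B A F \<omega> \<and> (\<nexists>G. cpu_disintegration B A F \<omega> (\<omega> \<circ> F) G)"
    using two_states[of True] cring_mat2_iff by blast
  show "\<exists>(B :: matrix_algebra) (A :: matrix_algebra) F \<omega>. bayes_data B A F \<omega> \<and>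
      \<not> cring A \<and> \<not> ae_deterministic B A F \<omega> \<and> (\<nexists>G. cpu_disintegration B A F \<omega> (\<omega> \<circ> F) G)"
    using two_states[of False] cring_mat2_iff by blast
  show "\<exists>(B :: matrix_algebra) (A :: matrix_algebra) F \<omega>. bayes_data B A F \<omega> \<and>
      cring A \<and> \<not> cring B \<and> (\<nexists>G. cpu_bayesian_inverse B A F \<omega> (\<omega> \<circ> F) G)"
    using two_states[of True] cring_mat2_iff by blast
  show "\<exists>(B :: matrix_algebra) (A :: matrix_algebra) F \<omega>. bayes_data B A F \<omega> \<and>
      \<not> cring A \<and> \<not> cring B \<and> (\<nexists>G. cpu_bayesian_inverse B A F \<omega> (\<omega> \<circ> F) G)"
    using two_states[of False] cring_mat2_iff by blast
qed

end
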